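(* The number of bounded affine permutations of size $n$ satisfies \[|\widetilde{S}^{/\!/}_n|\sim\sqrt{\frac{3}{2\pi e}}\,n^{-1/2}\,2^n\,n!\qquad(n\to\infty).\]
   Context: An affine permutation of size $n$ is a bijection $\sigma:\mathbb{Z}\to\mathbb{Z}$ with $\sigma(i+n)=\sigma(i)+n$ for all $i\in\mathbb{Z}$ and $\sum_{i=1}^n\sigma(i)=\sum_{i=1}^ni$. It is bounded if $|\sigma(i)-i|<n$ for all $i$. $\widetilde{S}^{/\!/}_n$ denotes the set of bounded affine permutations of size $n$. *)

theory Defs
  imports "HOL-Analysis.Analysis" "HOL-Library.Landau_Symbols"
begin

definition affine_permutation :: "nat \<Rightarrow> (int \<Rightarrow> int) \<Rightarrow> bool" where
  "affine_permutation n \<sigma> \<longleftrightarrow>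
     bij \<sigma> \<and>
     (\<forall>i. \<sigma> (i + int n) = \<sigma> i + int n) \<and>
     (\<Sum>i = 1..int n. \<sigma> i) = (\<Sum>i = 1..int n. i)"

definition bounded_affine_permutations :: "nat \<Rightarrow> (int \<Rightarrow> int) set" where
  "bounded_affine_permutations n =
     {\<sigma>. affine_permutation n \<sigma> \<and> (\<forall>i. \<bar>\<sigma> i - i\<bar> < int n)}"

end

theory Submission
  imports Defs "HOL-Combinatorics.Permutations" "HOL-Complex_Analysis.Complex_Analysis"
    "HOL-Probability.Distributions" "HOL-Real_Asymp.Real_Asymp"
begin

text \<open>
  Reducing a bounded affine permutation modulo \<open>n\<close> gives a permutation \<open>p\<close> of \<open>n\<close> points together
  with the set of points that are wrapped around, which must contain as many exceedances as
  anti-exceedances. So the count is the constant term in \<open>z\<close> of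
  \<open>\<Sum>p. (1 + z)^e (1 + 1/z)^d\<close>, where \<open>e\<close> and \<open>d\<close> are the numbers of exceedances and
  anti-exceedances. Writing \<open>1 = (1 + 1/z) - 1/z\<close> at the fixed points turns this into
  \<open>\<Sum>k. (n choose k) (-1/z)^k (1 + 1/z)^(n-k) A\<^bsub>n-k\<^esub>(z)\<close> with the Eulerian polynomials
  \<open>A\<^bsub>m\<^esub>(z) = \<Sum>p. z^e\<close>.

  Up to an elementary factor, \<open>A\<^bsub>m\<^esub>(exp w)\<close> is the \<open>m\<close>-th derivative of \<open>exp w / (1 - exp w)\<close>, hence near
  \<open>w = 0\<close> it is governed by the pole \<open>-1/w\<close>. This gives a Gaussian limit for \<open>A\<^bsub>m\<^esub>(cis (t / sqrt m)) / m!\<close>, and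
  dominated convergence shows that the Fourier integral of the \<open>k\<close>-th summand, multiplied by
  \<open>sqrt n / (2^n n!)\<close>, tends to \<open>(-1/2)^k / k! * sqrt (6 pi)\<close>. Summing over \<open>k\<close> by Tannery's theorem
  produces the factor \<open>exp (-1/2)\<close>.
\<close>

subsection \<open>Exceedances and Eulerian polynomials\<close>

definition exc :: "'a::linorder set \<Rightarrow> ('a \<Rightarrow> 'a) \<Rightarrow> 'a set" where
  "exc S p = {i \<in> S. i < p i}"

lemma exc_subset: "exc S p \<subseteq> S"
  by (auto simp: exc_def)

lemma finite_exc [simp]: "finite S \<Longrightarrow> finite (exc S p)"
  by (auto simp: exc_def)

lemma card_fix_exc_le: "card {i\<in>{..<n}. p i = i} + card (exc {..<n} p) \<le> n"
proof -
  have "card {i\<in>{..<n}. p i = i} + card (exc {..<n} p) = card ({i\<in>{..<n}. p i = i} \<union> exc {..<n} p)"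
    by (intro card_Un_disjoint[symmetric]) (auto simp: exc_def)
  also have "\<dots> \<le> card {..<n}"
    by (intro card_mono) (auto simp: exc_def)
  finally show ?thesis by simp
qed

text \<open>The composite inserts \<open>a\<close> into the cycle of \<open>q\<close> between
  \<open>i\<close> and \<open>q i\<close>: now \<open>i\<close> maps to the maximum and is an
  exceedance, \<open>a\<close> maps downwards, and all other values are unchanged.\<close>

lemma exc_transpose_insert_max:
  assumes q: "q permutes S" and max: "\<And>x. x \<in> S \<Longrightarrow> x < a" and i: "i \<in> S"
  shows "exc (insert a S) (Transposition.transpose a (q i) \<circ> q) = insert i (exc S q)"
proof -
  have a: "a \<notin> S" using max by blast
  have qa: "q a = a" using q a by (simp add: permutes_not_in)
  have qS: "q x \<in> S" if "x \<in> S" for x using q that by (simp add: permutes_in_image)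
  have inj: "q x = q i \<longleftrightarrow> x = i" for x using permutes_inj[OF q] by (simp add: inj_eq)
  have "x \<in> exc (insert a S) (Transposition.transpose a (q i) \<circ> q) \<longleftrightarrow> x \<in> insert i (exc S q)" for x
  proof (cases "x = a")
    case True
    then show ?thesis using qa a i max[of "q i"] qS[of i] by (auto simp: exc_def)
  next
    case False
    show ?thesis
    proof (cases "x = i")
      case True
      then show ?thesis using i max by (auto simp: exc_def)
    next
      case False
      then have "q x \<noteq> q i" by (simp add: inj)
      moreover have "q x \<noteq> a" if "x \<in> S" using qS[OF that] a by auto
      ultimately show ?thesis using \<open>x \<noteq> a\<close> False by (auto simp: exc_def Transposition.transpose_def)
    qed
  qed
  then show ?thesis by blast
qed

text \<open>This is the Eulerian recurrence with an arbitrary weight \<open>G\<close>. Leaving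
  \<open>a\<close> fixed, or inserting it after an existing exceedance, keeps the count; inserting
  it after any of the other points raises the count by one.\<close>

lemma sum_exc_insert_max:
  fixes G :: "nat \<Rightarrow> 'b::comm_semiring_1"
  assumes fin: "finite S" and max: "\<And>x. x \<in> S \<Longrightarrow> x < a"
  shows "(\<Sum>p | p permutes insert a S. G (card (exc (insert a S) p))) =
    (\<Sum>p | p permutes S. of_nat (Suc (card (exc S p))) * G (card (exc S p)) +
        of_nat (card S - card (exc S p)) * G (Suc (card (exc S p))))"
proof -
  have a: "a \<notin> S" using max by blast
  have "(\<Sum>b\<in>insert a S. G (card (exc (insert a S) (Transposition.transpose a b \<circ> q)))) =
      of_nat (Suc (card (exc S q))) * G (card (exc S q)) +
        of_nat (card S - card (exc S q)) * G (Suc (card (exc S q)))"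
    if q: "q permutes S" for q
  proof -
    have qa: "q a = a" using q a by (simp add: permutes_not_in)
    have *: "exc (insert a S) q = exc S q" using qa by (auto simp: exc_def)
    \<comment> \<open>Reindexing by \<open>b = q i\<close> names the point after which
      \<open>a\<close> is inserted.\<close>
    have "(\<Sum>b\<in>S. G (card (exc (insert a S) (Transposition.transpose a b \<circ> q)))) =
        (\<Sum>i\<in>S. G (card (exc (insert a S) (Transposition.transpose a (q i) \<circ> q))))"
      using sum.permute[OF q, of "\<lambda>b. G (card (exc (insert a S) (Transposition.transpose a b \<circ> q)))"]
      by (simp add: o_def)
    also have "\<dots> = (\<Sum>i\<in>S. G (card (insert i (exc S q))))"
      by (intro sum.cong refl) (simp add: exc_transpose_insert_max[OF q max])
    also have "\<dots> = (\<Sum>i\<in>exc S q. G (card (insert i (exc S q)))) +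
        (\<Sum>i\<in>S - exc S q. G (card (insert i (exc S q))))"
      using fin by (simp add: sum.subset_diff[OF exc_subset[of S q] fin] add.commute)
    also have "(\<Sum>i\<in>exc S q. G (card (insert i (exc S q)))) =
        of_nat (card (exc S q)) * G (card (exc S q))"
      by (simp add: insert_absorb)
    also have "(\<Sum>i\<in>S - exc S q. G (card (insert i (exc S q)))) =
        of_nat (card S - card (exc S q)) * G (Suc (card (exc S q)))"
      using fin by (simp add: card_Diff_subset[OF _ exc_subset])
    finally show ?thesis using a fin by (simp add: * o_def algebra_simps)
  qed
  then show ?thesis
    unfolding sum_over_permutations_insert[OF fin a]
    by (subst sum.swap) (auto intro!: sum.cong)
qed

text \<open>Both sides obey the same recurrence when a maximum is added. \<open>G\<close> stays
  arbitrary in the induction because the recurrence replaces it by a new weight.\<close>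

lemma sum_exc_card:
  fixes S :: "nat set" and G :: "nat \<Rightarrow> 'b::comm_semiring_1"
  assumes "finite S"
  shows "(\<Sum>p | p permutes S. G (card (exc S p))) =
    (\<Sum>p | p permutes {..<card S}. G (card (exc {..<card S} p)))"
  using assms
proof (induction S arbitrary: G rule: finite_linorder_max_induct)
  case empty
  then show ?case by simp
next
  case (insert a S)
  have c: "card (insert a S) = Suc (card S)" using insert by (subst card_insert_disjoint) auto
  have *: "{..<Suc m} = insert m {..<m}" for m :: nat by auto
  show ?case
    unfolding c * using insert.hyps
    by (subst (1 2) sum_exc_insert_max) (simp_all del: of_nat_Suc add: insert.IH[of "\<lambda>e. of_nat (Suc e) * G e + of_nat (card S - e) * G (Suc e)"])
qed

section \<open>Sums over sets of fixed points\<close>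

lemma sum_Pow_by_card:
  fixes g :: "nat \<Rightarrow> 'b::comm_semiring_1"
  assumes "finite S"
  shows "(\<Sum>T\<in>Pow S. g (card T)) = (\<Sum>k\<le>card S. of_nat (card S choose k) * g k)"
proof -
  have "(\<Sum>T\<in>Pow S. g (card T)) = (\<Sum>k\<le>card S. \<Sum>T | T \<in> Pow S \<and> card T = k. g (card T))"
    using assms by (intro sum.group[symmetric]) (auto simp: card_mono)
  also have "\<dots> = (\<Sum>k\<le>card S. of_nat (card S choose k) * g k)"
    using assms by (intro sum.cong refl) (simp add: n_subsets)
  finally show ?thesis .
qed

text \<open>Exchange the two sums: a permutation fixing \<open>T\<close> pointwise is a permutation
  of the complement with the same exceedances, and only the size of that complement matters.\<close>

lemma sum_exc_fixed_subsets:
  fixes H :: "nat \<Rightarrow> nat \<Rightarrow> 'b::comm_semiring_1"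
  shows "(\<Sum>p | p permutes {..<n}. \<Sum>T\<in>Pow {i\<in>{..<n}. p i = i}. H (card T) (card (exc {..<n} p))) =
    (\<Sum>k\<le>n. of_nat (n choose k) * (\<Sum>p | p permutes {..<n - k}. H k (card (exc {..<n - k} p))))"
proof -
  let ?P = "\<lambda>p T. \<forall>i\<in>T. p i = i"
  have eq: "{p. p permutes {..<n} \<and> ?P p T} = {p. p permutes ({..<n} - T)}" if "T \<subseteq> {..<n}" for T
    using that by (auto simp: permutes_def)
  have exc_eq: "exc {..<n} p = exc ({..<n} - T) p" if "p permutes ({..<n} - T)" for p T
    using that by (fastforce simp: exc_def permutes_def)
  have "(\<Sum>p | p permutes {..<n}. \<Sum>T\<in>Pow {i\<in>{..<n}. p i = i}. H (card T) (card (exc {..<n} p))) =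
    (\<Sum>p | p permutes {..<n}. \<Sum>T | T \<in> Pow {..<n} \<and> ?P p T. H (card T) (card (exc {..<n} p)))"
    by (intro sum.cong refl) auto
  also have "\<dots> = (\<Sum>T\<in>Pow {..<n}. \<Sum>p | p \<in> {p. p permutes {..<n}} \<and> ?P p T. H (card T) (card (exc {..<n} p)))"
    by (rule sum.swap_restrict) (auto simp: finite_permutations)
  also have "\<dots> = (\<Sum>T\<in>Pow {..<n}. \<Sum>p | p permutes {..<n} - T. H (card T) (card (exc ({..<n} - T) p)))"
    by (intro sum.cong) (auto simp: eq exc_eq)
  also have "\<dots> = (\<Sum>T\<in>Pow {..<n}. \<Sum>p | p permutes {..<n - card T}. H (card T) (card (exc {..<n - card T} p)))"
  proof (rule sum.cong[OF refl])
    fix T assume "T \<in> Pow {..<n}"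
    then have "finite T" "T \<subseteq> {..<n}" using finite_subset by auto
    then have "card ({..<n} - T) = n - card T" by (simp add: card_Diff_subset)
    then show "(\<Sum>p | p permutes {..<n} - T. H (card T) (card (exc ({..<n} - T) p))) =
      (\<Sum>p | p permutes {..<n - card T}. H (card T) (card (exc {..<n - card T} p)))"
      using sum_exc_card[of "{..<n} - T" "H (card T)"] by simp
  qed
  also have "\<dots> = (\<Sum>k\<le>n. of_nat (n choose k) * (\<Sum>p | p permutes {..<n - k}. H k (card (exc {..<n - k} p))))"
    using sum_Pow_by_card[of "{..<n}" "\<lambda>k. \<Sum>p | p permutes {..<n - k}. H k (card (exc {..<n - k} p))"] by simp
  finally show ?thesis .
qed

definition eulerian :: "nat \<Rightarrow> complex \<Rightarrow> complex" where
  "eulerian m z = (\<Sum>p | p permutes {..<m}. z ^ card (exc {..<m} p))"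

text \<open>The derivative of \<open>eulerian m\<close>. The truncated exponent at zero exceedances
  is harmless, since its coefficient vanishes.\<close>

definition eulerian' :: "nat \<Rightarrow> complex \<Rightarrow> complex" where
  "eulerian' m z = (\<Sum>p | p permutes {..<m}. of_nat (card (exc {..<m} p)) * z ^ (card (exc {..<m} p) - 1))"

lemma eulerian_0 [simp]: "eulerian 0 z = 1"
  by (simp add: eulerian_def exc_def)

text \<open>Take \<open>G e = z ^ e\<close> in the recurrence; the terms with a factor
  \<open>e\<close> assemble into the derivative.\<close>

lemma eulerian_Suc:
  "eulerian (Suc m) z = (1 + of_nat m * z) * eulerian m z + z * (1 - z) * eulerian' m z"
proof -
  have eq: "{..<Suc m} = insert m {..<m}" by auto
  have le: "card (exc {..<m} p) \<le> m" for p
    using card_mono[OF _ exc_subset[of "{..<m}" p]] by simp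
  show ?thesis
    unfolding eulerian_def eulerian'_def eq
  proof (subst sum_exc_insert_max, simp_all add: sum_distrib_left flip: sum.distrib, intro sum.cong refl)
    fix p
    show "(1 + of_nat (card (exc {..<m} p))) * z ^ card (exc {..<m} p) +
         of_nat (m - card (exc {..<m} p)) * (z * z ^ card (exc {..<m} p)) =
         (1 + of_nat m * z) * z ^ card (exc {..<m} p) +
         z * (1 - z) * (of_nat (card (exc {..<m} p)) * z ^ (card (exc {..<m} p) - Suc 0))"
      using le[of p] by (cases "card (exc {..<m} p)") (auto simp: of_nat_diff algebra_simps)
  qed
qed

lemma has_field_derivative_eulerian [derivative_intros]:
  assumes "(f has_field_derivative f') (at x within A)"
  shows "((\<lambda>x. eulerian m (f x)) has_field_derivative eulerian' m (f x) * f') (at x within A)"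
  unfolding eulerian_def eulerian'_def sum_distrib_right
  by (intro DERIV_sum) (auto intro!: derivative_eq_intros assms)

text \<open>The exponent of \<open>1 + 1 / z\<close> on the left counts anti-exceedances, so fixed
  points have weight 1. Expanding that weight as \<open>-1 / z + (1 + 1 / z)\<close> selects a set
  \<open>T\<close> of fixed points; every other point then carries \<open>1 + 1 / z\<close>, with an
  extra \<open>z\<close> at exceedances because \<open>1 + z = z * (1 + 1 / z)\<close>.\<close>

lemma sum_permutes_fix_exc:
  assumes "z \<noteq> 0"
  shows "(\<Sum>p | p permutes {..<n}. (1 + z) ^ card (exc {..<n} p) *
      (1 + 1 / z) ^ (n - card {i\<in>{..<n}. p i = i} - card (exc {..<n} p))) =
    (\<Sum>k\<le>n. of_nat (n choose k) * (-1 / z) ^ k * (1 + 1 / z) ^ (n - k) * eulerian (n - k) z)"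
proof -
  let ?e = "\<lambda>m p. card (exc {..<m} p)"
  let ?F = "\<lambda>p. {i\<in>{..<n}. p i = i}"
  let ?H = "\<lambda>k e. (1 + z) ^ e * ((-1 / z) ^ k * (1 + 1 / z) ^ (n - k - e))"
  have le: "?e m p \<le> m" for m p
    using card_mono[OF _ exc_subset[of "{..<m}" p]] by simp
  have 1: "(1 + z) ^ ?e n p * (1 + 1 / z) ^ (n - card (?F p) - ?e n p) =
      (\<Sum>T\<in>Pow (?F p). ?H (card T) (?e n p))" for p
  proof -
    let ?f = "card (?F p)"
    have fe: "?f + ?e n p \<le> n" by (rule card_fix_exc_le)
    have "1 = (-1 / z + (1 + 1 / z)) ^ ?f" by simp
    also have "\<dots> = (\<Sum>k\<le>?f. of_nat (?f choose k) * ((-1 / z) ^ k * (1 + 1 / z) ^ (?f - k)))"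
      unfolding binomial_ring by (simp add: mult.assoc)
    also have "\<dots> = (\<Sum>T\<in>Pow (?F p). (-1 / z) ^ card T * (1 + 1 / z) ^ (?f - card T))"
      by (rule sum_Pow_by_card[symmetric]) simp
    finally have "(1 + z) ^ ?e n p * (1 + 1 / z) ^ (n - ?f - ?e n p) =
      (1 + z) ^ ?e n p * (1 + 1 / z) ^ (n - ?f - ?e n p) *
        (\<Sum>T\<in>Pow (?F p). (-1 / z) ^ card T * (1 + 1 / z) ^ (?f - card T))" by simp
    also have "\<dots> = (\<Sum>T\<in>Pow (?F p). ?H (card T) (?e n p))"
      unfolding sum_distrib_left
    proof (intro sum.cong refl)
      fix T assume "T \<in> Pow (?F p)"
      then have "card T \<le> ?f" by (intro card_mono) auto
      with fe have "n - card T - ?e n p = (n - ?f - ?e n p) + (?f - card T)" by linarith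
      then show "(1 + z) ^ ?e n p * (1 + 1 / z) ^ (n - ?f - ?e n p) *
          ((-1 / z) ^ card T * (1 + 1 / z) ^ (?f - card T)) = ?H (card T) (?e n p)"
        by (simp add: power_add mult_ac)
    qed
    finally show ?thesis .
  qed
  have 2: "(\<Sum>p | p permutes {..<n - k}. ?H k (?e (n - k) p)) =
      (-1 / z) ^ k * (1 + 1 / z) ^ (n - k) * eulerian (n - k) z" for k
  proof -
    have "?H k (?e (n - k) p) = (-1 / z) ^ k * (1 + 1 / z) ^ (n - k) * z ^ ?e (n - k) p" for p
    proof -
      have "1 + z = z * (1 + 1 / z)" using assms by (simp add: field_simps)
      then have "(1 + z) ^ ?e (n - k) p * (1 + 1 / z) ^ (n - k - ?e (n - k) p) =
          z ^ ?e (n - k) p * (1 + 1 / z) ^ (n - k)"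
        using le_add_diff_inverse[OF le[of "n - k" p]]
        by (simp only: power_mult_distrib mult.assoc power_add[symmetric])
      then show ?thesis by (simp add: mult_ac)
    qed
    then show ?thesis unfolding eulerian_def sum_distrib_left by (intro sum.cong[OF refl])
  qed
  show ?thesis
    unfolding 1 sum_exc_fixed_subsets[where H = ?H] 2 by (simp only: mult.assoc)
qed

subsection \<open>Eulerian polynomials near 1\<close>

text \<open>The quotient equals \<open>-(1 / w) * (exp w / q w)\<close>, where \<open>q\<close> is
  \<open>(exp w - 1) / w\<close> with its singularity removed and \<open>q 0 = 1\<close>; hence the
  pole is simple with residue -1.\<close>

lemma exp_over_one_minus_exp_principal_part:
  obtains \<epsilon> and r :: "complex \<Rightarrow> complex" where "0 < \<epsilon>" "r holomorphic_on ball 0 \<epsilon>"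
    "\<And>w. w \<in> ball 0 \<epsilon> - {0} \<Longrightarrow> exp w \<noteq> (1::complex)"
    "\<And>w. w \<in> ball 0 \<epsilon> - {0} \<Longrightarrow> exp w / (1 - exp w) = - 1 / w + r w"
proof -
  define q :: "complex \<Rightarrow> complex" where "q = (\<lambda>w. if w = 0 then deriv exp 0 else (exp w - exp 0) / (w - 0))"
  have q_hol: "q holomorphic_on UNIV"
    unfolding q_def by (rule pole_lemma) (auto intro!: holomorphic_intros)
  have q0: "q 0 = 1"
    unfolding q_def using DERIV_imp_deriv[OF DERIV_exp[of "0::complex"]] by simp
  have "isCont q 0"
    using q_hol holomorphic_on_imp_continuous_on continuous_on_eq_continuous_at open_UNIV by blast
  then have "\<forall>\<^sub>F w in at 0. q w \<noteq> 0"
    using q0 by (auto simp: isCont_def intro!: tendsto_imp_eventually_ne)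
  then obtain \<epsilon> where \<epsilon>: "\<epsilon> > 0" "\<And>w. w \<in> ball 0 \<epsilon> \<Longrightarrow> q w \<noteq> 0"
    unfolding eventually_at using q0 by (metis UNIV_I dist_commute mem_ball zero_neq_one)
  \<comment> \<open>Removing the pole leaves \<open>s w / w\<close>, which extends holomorphically
    because \<open>s 0 = 0\<close>.\<close>
  define s where "s = (\<lambda>w. 1 - exp w / q w)"
  have s_hol: "s holomorphic_on ball 0 \<epsilon>"
    unfolding s_def using \<epsilon> by (auto intro!: holomorphic_intros holomorphic_on_subset[OF q_hol])
  define r where "r = (\<lambda>w. if w = 0 then deriv s 0 else (s w - s 0) / (w - 0))"
  have r_hol: "r holomorphic_on ball 0 \<epsilon>"
    unfolding r_def by (rule pole_lemma) (use s_hol \<epsilon> in auto)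
  have ne1: "exp w \<noteq> (1::complex)" if "w \<in> ball 0 \<epsilon> - {0}" for w
    using \<epsilon>(2)[of w] that by (auto simp: q_def)
  have "exp w / (1 - exp w) = - 1 / w + r w" if "w \<in> ball 0 \<epsilon> - {0}" for w
  proof -
    have "w \<noteq> 0" using that by simp
    then have r: "r w = (1 - exp w / ((exp w - 1) / w)) / w" by (simp add: r_def s_def q0, simp add: q_def)
    show ?thesis unfolding r using ne1[OF that] \<open>w \<noteq> 0\<close> by (simp add: divide_simps) (simp add: algebra_simps)
  qed
  then show ?thesis using that \<epsilon>(1) r_hol ne1 by blast
qed

text \<open>Both sides are the \<open>m\<close>-th derivative of \<open>exp w / (1 - exp w)\<close>:
  on the left differentiation acts through \<open>eulerian_Suc\<close>, on the right it acts on the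
  principal part and on \<open>r\<close> separately.\<close>

lemma eulerian_exp_eq:
  fixes r :: "complex \<Rightarrow> complex"
  assumes r: "r holomorphic_on ball 0 \<epsilon>"
    and ne1: "\<And>w. w \<in> ball 0 \<epsilon> - {0} \<Longrightarrow> exp w \<noteq> (1::complex)"
    and eq: "\<And>w. w \<in> ball 0 \<epsilon> - {0} \<Longrightarrow> exp w / (1 - exp w) = - 1 / w + r w"
    and w: "w \<in> ball 0 \<epsilon> - {0}"
  shows "exp w * eulerian m (exp w) / (1 - exp w) ^ Suc m =
    (-1) ^ Suc m * fact m / w ^ Suc m + (deriv ^^ m) r w"
  using w
proof (induction m arbitrary: w)
  case 0
  then show ?case using eq[of w] by simp
next
  case (Suc m)
  let ?L = "\<lambda>w. exp w * eulerian m (exp w) / (1 - exp w) ^ Suc m"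
  let ?R = "\<lambda>w. (-1) ^ Suc m * fact m / w ^ Suc m + (deriv ^^ m) r w"
  have S: "open (ball 0 \<epsilon> - {0::complex})" by (simp add: open_delete)
  have w0: "w \<noteq> 0" and n1: "1 - exp w \<noteq> 0" using Suc.prems ne1[of w] by auto
  have "((deriv ^^ m) r has_field_derivative (deriv ^^ Suc m) r w) (at w)"
    using holomorphic_derivI[OF holomorphic_higher_deriv[OF r open_ball]] Suc.prems by auto
  moreover have "((\<lambda>w. w ^ Suc m) has_field_derivative (1 + of_nat m) * (1 * w ^ m)) (at w)"
    by (rule DERIV_power_Suc) simp
  from DERIV_divide[OF DERIV_const this, of "(-1) ^ Suc m * fact m"] w0
  have "((\<lambda>w. (-1) ^ Suc m * fact m / w ^ Suc m) has_field_derivative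
      (-1) ^ Suc (Suc m) * fact (Suc m) / w ^ Suc (Suc m)) (at w)"
    by (rule_tac DERIV_cong) (auto simp: field_simps)
  ultimately have "(?R has_field_derivative (-1) ^ Suc (Suc m) * fact (Suc m) / w ^ Suc (Suc m) + (deriv ^^ Suc m) r w) (at w)"
    by (rule_tac DERIV_add)
  moreover have "(?L has_field_derivative exp w * eulerian (Suc m) (exp w) / (1 - exp w) ^ Suc (Suc m)) (at w)"
  proof -
    define D P where "D = 1 - exp w" and "P = D ^ m"
    have DP: "D \<noteq> 0" "P \<noteq> 0" and D: "exp w = 1 - D" using n1 by (auto simp: D_def P_def)
    let ?E = "eulerian m (exp w)" and ?E' = "eulerian' m (exp w)"
    have num: "((\<lambda>w. exp w * eulerian m (exp w)) has_field_derivative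
        exp w * ?E + exp w * (?E' * exp w)) (at w)"
      by (auto intro!: derivative_eq_intros simp: algebra_simps)
    have "((\<lambda>w. 1 - exp w) has_field_derivative - exp w) (at w)"
      by (auto intro!: derivative_eq_intros)
    from DERIV_divide[OF num DERIV_power_Suc[OF this, of m]] DP
    have "(?L has_field_derivative
        ((exp w * ?E + exp w * (?E' * exp w)) * (D * P) - exp w * ?E * ((1 + of_nat m) * (- exp w * P)))
          / ((D * P) * (D * P))) (at w)"
      by (simp add: D_def P_def)
    moreover have "((exp w * ?E + exp w * (?E' * exp w)) * (D * P) - exp w * ?E * ((1 + of_nat m) * (- exp w * P)))
          / ((D * P) * (D * P)) = exp w * eulerian (Suc m) (exp w) / (D * (D * P))"
      unfolding eulerian_Suc D using DP by (simp add: divide_simps) (simp add: algebra_simps)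
    ultimately show ?thesis by (simp add: D_def P_def)
  qed
  \<comment> \<open>By the induction hypothesis both functions agree on an open set around
    \<open>w\<close>, so uniqueness of derivatives gives the next case.\<close>
  then have "(?R has_field_derivative exp w * eulerian (Suc m) (exp w) / (1 - exp w) ^ Suc (Suc m)) (at w)"
    by (rule has_field_derivative_transform_within_open[OF _ S Suc.prems Suc.IH])
  ultimately show ?case by (rule DERIV_unique[symmetric])
qed

text \<open>Solving the previous identity for the Eulerian polynomial leaves a relative error
  governed by the \<open>m\<close>-th derivative of \<open>r\<close> over \<open>m!\<close>.
  Cauchy's inequality makes it geometric in \<open>m\<close>, with constants independent of
  \<open>m\<close>.\<close>

lemma eulerian_exp_asymptotic:
  obtains \<delta> B :: real where "0 < \<delta>" "0 < B"
    "\<And>w m. 0 < norm w \<Longrightarrow> norm w < \<delta> \<Longrightarrow>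
       norm (eulerian m (exp w) / fact m - exp (-w) * ((exp w - 1) / w) ^ Suc m)
         \<le> norm (exp (-w) * ((exp w - 1) / w) ^ Suc m) * (B * (norm w / \<delta>) ^ Suc m)"
proof -
  obtain \<epsilon> and r :: "complex \<Rightarrow> complex" where \<epsilon>: "0 < \<epsilon>" and r: "r holomorphic_on ball 0 \<epsilon>"
    and ne1: "\<And>w. w \<in> ball 0 \<epsilon> - {0} \<Longrightarrow> exp w \<noteq> (1::complex)"
    and eq: "\<And>w. w \<in> ball 0 \<epsilon> - {0} \<Longrightarrow> exp w / (1 - exp w) = - 1 / w + r w"
    using exp_over_one_minus_exp_principal_part by blast
  \<comment> \<open>With a third of the radius, the disc of radius \<delta> about any
    \<open>w\<close> of norm below \<delta> lies in \<open>cball 0 (2 * \<delta>)\<close>, a compact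
    set where \<open>r\<close> is bounded.\<close>
  define \<delta> where "\<delta> = \<epsilon> / 3"
  have \<delta>: "\<delta> > 0" "\<epsilon> = 3 * \<delta>" using \<epsilon> by (auto simp: \<delta>_def)
  have "compact (r ` cball 0 (2 * \<delta>))"
    using \<delta> by (intro compact_continuous_image holomorphic_on_imp_continuous_on holomorphic_on_subset[OF r]) auto
  then obtain B0 where B0: "B0 > 0" "\<And>w. w \<in> cball 0 (2 * \<delta>) \<Longrightarrow> norm (r w) \<le> B0"
    using compact_imp_bounded bounded_pos by (metis image_eqI)
  show ?thesis
  proof (rule that[of \<delta> "\<delta> * B0"])
    fix w :: complex and m assume w: "0 < norm w" "norm w < \<delta>"
    have sub: "cball w \<delta> \<subseteq> cball 0 (2 * \<delta>)" "cball w \<delta> \<subseteq> ball 0 \<epsilon>"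
      using w \<delta> by (auto simp: subset_iff dist_norm) (smt (verit) norm_triangle_ineq4 norm_minus_commute dist_norm norm_triangle_sub)+
    have hb: "norm ((deriv ^^ m) r w) \<le> fact m * B0 / \<delta> ^ m"
    proof (rule Cauchy_inequality)
      show "r holomorphic_on ball w \<delta>" "continuous_on (cball w \<delta>) r"
        using sub(2) ball_subset_cball
        by (auto intro!: holomorphic_on_subset[OF r] holomorphic_on_imp_continuous_on)
      fix x assume "norm (w - x) = \<delta>"
      then show "norm (r x) \<le> B0" using sub(1) by (intro B0) (auto simp: dist_norm)
    qed (use \<delta> in auto)
    have wb: "w \<in> ball 0 \<epsilon> - {0}" using w \<delta> by auto
    let ?u = "exp (-w) * ((exp w - 1) / w) ^ Suc m"
    have n1: "1 - exp w \<noteq> 0" using ne1[OF wb] by auto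
    have "exp (-w) * (1 - exp w) ^ Suc m * (exp w * eulerian m (exp w) / (1 - exp w) ^ Suc m) = eulerian m (exp w)"
      using n1 by (simp add: exp_minus)
    then have "eulerian m (exp w) = exp (-w) * (1 - exp w) ^ Suc m * ((-1) ^ Suc m * fact m / w ^ Suc m + (deriv ^^ m) r w)"
      using eulerian_exp_eq[OF r ne1 eq wb, of m] by (simp only:)
    moreover have "(1 - exp w) ^ Suc m = (-1) ^ Suc m * (exp w - 1) ^ Suc m"
      using power_minus[of "exp w - 1" "Suc m"] by (simp only: minus_diff_eq)
    \<comment> \<open>Here \<open>s\<close> is the sign \<open>(-1) ^ Suc m\<close>,
      \<open>v\<close> is \<open>(exp w - 1) ^ Suc m\<close>, \<open>W\<close> is
      \<open>w ^ Suc m\<close> and \<open>R\<close> is the derivative of \<open>r\<close>; the main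
      terms cancel exactly since \<open>s * s = 1\<close>.\<close>
    moreover have "e * (s * v) * (s * f / W + R) / f - e * (v / W) = e * (v / W) * (s * W * (R / f))"
      if "s * s = 1" "W \<noteq> 0" "f \<noteq> 0" for e s v f W R :: complex
    proof -
      have "e * (s * v) * (s * f / W + R) / f = (s * s) * (e * (v / W)) + e * (v / W) * (s * W * (R / f))"
        using that(2,3) by (simp add: field_simps)
      then show ?thesis using that(1) by simp
    qed
    from this[of "(-1) ^ Suc m" "w ^ Suc m" "fact m"]
    have "exp (-w) * ((-1) ^ Suc m * (exp w - 1) ^ Suc m) * ((-1) ^ Suc m * fact m / w ^ Suc m + (deriv ^^ m) r w) / fact m - ?u =
        ?u * ((-1) ^ Suc m * w ^ Suc m * ((deriv ^^ m) r w / fact m))"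
      using w unfolding power_divide by (simp flip: power_mult_distrib)
    ultimately have "eulerian m (exp w) / fact m - ?u = ?u * ((-1) ^ Suc m * w ^ Suc m * ((deriv ^^ m) r w / fact m))"
      by (simp only:)
    also have "norm \<dots> = norm ?u * (norm w ^ Suc m * (norm ((deriv ^^ m) r w) / fact m))"
      by (simp add: norm_mult norm_power norm_divide)
    also have "\<dots> \<le> norm ?u * (norm w ^ Suc m * (B0 / \<delta> ^ m))"
      using hb by (intro mult_left_mono) (auto simp: field_simps)
    also have "norm w ^ Suc m * (B0 / \<delta> ^ m) = \<delta> * B0 * (norm w / \<delta>) ^ Suc m"
      using \<delta> by (simp add: field_simps)
    finally show "norm (eulerian m (exp w) / fact m - ?u) \<le> norm ?u * (\<delta> * B0 * (norm w / \<delta>) ^ Suc m)" .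
  qed (use \<delta> B0 in auto)
qed

subsection \<open>Asymptotics of the Fourier integrals\<close>

text \<open>The asymptotic formula is only local at 1; this crude bound on the whole circle serves
  the domination.\<close>

lemma norm_eulerian_cis_le: "norm (eulerian m (cis \<theta>)) \<le> fact m"
proof -
  have "norm (eulerian m (cis \<theta>)) \<le> (\<Sum>p | p permutes {..<m}. 1)"
    unfolding eulerian_def by (rule sum_norm_le) (simp add: norm_power)
  then show ?thesis by (simp add: card_permutations)
qed

lemma eulerian_1 [simp]: "eulerian m 1 = fact m"
  by (simp add: eulerian_def card_permutations)

section \<open>Gaussian limits of the Eulerian and cosine factors\<close>

lemma cis_minus_one_div:
  assumes "\<theta> \<noteq> 0"
  shows "(cis \<theta> - 1) / (\<i> * of_real \<theta>) = cis (\<theta> / 2) * of_real (sin (\<theta> / 2) / (\<theta> / 2))"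
proof -
  have 1: "cis \<theta> = cis (\<theta> / 2) * cis (\<theta> / 2)" by (simp add: cis_mult)
  have 2: "cis (\<theta> / 2) * cis (- (\<theta> / 2)) = 1" by (simp add: cis_mult)
  have 3: "cis (\<theta> / 2) - cis (- (\<theta> / 2)) = 2 * \<i> * of_real (sin (\<theta> / 2))"
    by (simp add: complex_eq_iff)
  have "cis \<theta> - 1 = cis (\<theta> / 2) * (cis (\<theta> / 2) - cis (- (\<theta> / 2)))"
    using 1 2 by (simp add: algebra_simps)
  then show ?thesis unfolding 3 using assms by (simp add: field_simps)
qed

lemma sinc_power_tendsto:
  assumes "t \<noteq> 0"
  shows "(\<lambda>m. (sin (t / sqrt (real m) / 2) / (t / sqrt (real m) / 2)) ^ Suc m) \<longlonglongrightarrow> exp (- t\<^sup>2 / 24)"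
\<comment> \<open>The symbolic expansion needs the sign of \<open>t\<close>. The constant 24 comes
  from \<open>sin x / x = 1 - x^2 / 6 + ...\<close> at \<open>x = t / (2 * sqrt m)\<close>.\<close>
proof (cases "t > 0")
  case True
  with assms show ?thesis by (real_asymp simp: power2_eq_square)
next
  case False
  with assms have "t < 0" by simp
  with assms show ?thesis by (real_asymp simp: power2_eq_square)
qed

lemma cos_power_tendsto:
  "(\<lambda>m. cos (t / sqrt (real m) / 2) ^ m) \<longlonglongrightarrow> exp (- t\<^sup>2 / 8)"
proof (cases "t = 0")
  case True
  then show ?thesis by simp
next
  case False
  then consider "t > 0" | "t < 0" by linarith
  then show ?thesis by cases (real_asymp simp: power2_eq_square)+
qed

text \<open>A central limit theorem: \<open>eulerian m (cis \<theta>) / fact m\<close> is the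
  characteristic function of the number of exceedances of a uniform permutation, and the factor
  \<open>cis\<close> recentres it by \<open>m / 2\<close>.\<close>

lemma eulerian_cis_tendsto:
  "(\<lambda>m. eulerian m (cis (t / sqrt m)) / fact m * cis (- (t / sqrt m) * m / 2)) \<longlonglongrightarrow> of_real (exp (- t\<^sup>2 / 24))"
proof (cases "t = 0")
  case True
  then show ?thesis by simp
next
  case t: False
  obtain \<delta> B :: real where \<delta>: "0 < \<delta>" "0 < B" and bound:
    "\<And>w m. 0 < norm w \<Longrightarrow> norm w < \<delta> \<Longrightarrow>
       norm (eulerian m (exp w) / fact m - exp (-w) * ((exp w - 1) / w) ^ Suc m)
         \<le> norm (exp (-w) * ((exp w - 1) / w) ^ Suc m) * (B * (norm w / \<delta>) ^ Suc m)"
    using eulerian_exp_asymptotic by blast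
  define \<theta> where "\<theta> m = t / sqrt (real m)" for m :: nat
  define w where "w m = \<i> * of_real (\<theta> m)" for m :: nat
  define u where "u m = exp (- w m) * ((exp (w m) - 1) / w m) ^ Suc m" for m
  define s where "s m = (sin (\<theta> m / 2) / (\<theta> m / 2)) ^ Suc m" for m
  have ew: "exp (w m) = cis (\<theta> m)" for m by (simp add: w_def cis_conv_exp)
  have \<theta>_lim: "\<theta> \<longlonglongrightarrow> 0" unfolding \<theta>_def by real_asymp
  \<comment> \<open>The phases \<open>-\<theta>\<close>, \<open>(m + 1) * \<theta> / 2\<close> and
    \<open>-m * \<theta> / 2\<close> add up to \<open>-\<theta> / 2\<close>, which tends to 0; a
    real sinc power remains.\<close>
  have u_eq: "u m * cis (- \<theta> m * m / 2) = cis (- \<theta> m / 2) * of_real (s m)" if "m > 0" for m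
  proof -
    have "\<theta> m \<noteq> 0" using t that by (simp add: \<theta>_def)
    then have u: "u m = cis (- \<theta> m) * cis (Suc m * (\<theta> m / 2)) * of_real (s m)"
      unfolding u_def exp_minus ew unfolding w_def cis_minus_one_div[OF \<open>\<theta> m \<noteq> 0\<close>]
      by (simp only: s_def power_mult_distrib Complex.DeMoivre of_real_power cis_inverse mult.assoc)
    have "- \<theta> m + Suc m * (\<theta> m / 2) + (- \<theta> m * m / 2) = - \<theta> m / 2"
      by (simp add: field_simps)
    then have c: "cis (- \<theta> m) * cis (Suc m * (\<theta> m / 2)) * cis (- \<theta> m * m / 2) = cis (- \<theta> m / 2)"
      by (simp only: cis_mult)
    show ?thesis unfolding u c[symmetric] by (simp only: mult_ac)
  qed
  have s_le: "\<bar>s m\<bar> \<le> 1" for m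
  proof -
    have "\<bar>sin (\<theta> m / 2) / (\<theta> m / 2)\<bar> \<le> 1"
      using abs_sin_x_le_abs_x[of "\<theta> m / 2"] unfolding abs_divide
      by (cases "\<theta> m = 0") (simp_all add: divide_le_eq)
    then show ?thesis unfolding s_def power_abs by (intro power_le_one) auto
  qed
  have "(\<lambda>m. cis (- \<theta> m / 2) * of_real (s m)) \<longlonglongrightarrow> cis (- 0 / 2) * of_real (exp (- t\<^sup>2 / 24))"
    unfolding s_def \<theta>_def
    by (intro tendsto_intros sinc_power_tendsto t \<theta>_lim[unfolded \<theta>_def]) auto
  moreover have "\<forall>\<^sub>F m in sequentially. cis (- \<theta> m / 2) * of_real (s m) = u m * cis (- \<theta> m * m / 2)"
    using eventually_gt_at_top[of 0] by eventually_elim (rule u_eq[symmetric])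
  ultimately have "(\<lambda>m. u m * cis (- \<theta> m * m / 2)) \<longlonglongrightarrow> cis (- 0 / 2) * of_real (exp (- t\<^sup>2 / 24))"
    by (rule Lim_transform_eventually)
  then have main: "(\<lambda>m. u m * cis (- \<theta> m * m / 2)) \<longlonglongrightarrow> of_real (exp (- t\<^sup>2 / 24))"
    by simp
  have "(\<lambda>m. B * (1 / 2) ^ Suc m) \<longlonglongrightarrow> 0" by real_asymp
  \<comment> \<open>Once \<theta> is below \<open>\<delta> / 2\<close>, the geometric error has
    ratio at most 1/2, while \<open>u m\<close> has norm at most 1.\<close>
  moreover have "\<forall>\<^sub>F m in sequentially. norm ((eulerian m (cis (\<theta> m)) / fact m - u m) * cis (- \<theta> m * m / 2)) \<le> B * (1 / 2) ^ Suc m"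
  proof -
    have "\<forall>\<^sub>F m in sequentially. norm (\<theta> m) < \<delta> / 2"
      using tendstoD[OF \<theta>_lim, of "\<delta> / 2"] \<delta> by (simp add: dist_norm)
    then show ?thesis using eventually_gt_at_top[of 0]
    proof eventually_elim
      case (elim m)
      have nw: "norm (w m) = \<bar>\<theta> m\<bar>" by (simp add: w_def norm_mult)
      have \<theta>0: "\<theta> m \<noteq> 0" using t elim by (simp add: \<theta>_def)
      have "norm (u m) = norm (u m * cis (- \<theta> m * m / 2))" by (simp add: norm_mult)
      also have "\<dots> \<le> 1" using u_eq[of m] elim s_le[of m] by (simp add: norm_mult)
      finally have u1: "norm (u m) \<le> 1" .
      have "norm ((eulerian m (cis (\<theta> m)) / fact m - u m) * cis (- \<theta> m * m / 2)) = norm (eulerian m (exp (w m)) / fact m - u m)"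
        by (simp add: norm_mult ew)
      also have "\<dots> \<le> norm (u m) * (B * (norm (w m) / \<delta>) ^ Suc m)"
        unfolding u_def using elim \<delta> \<theta>0 by (intro bound) (auto simp: nw)
      also have "\<dots> \<le> 1 * (B * (1 / 2) ^ Suc m)"
        using u1 elim \<delta> by (intro mult_mono power_mono) (auto simp: nw field_simps)
      finally show ?case by simp
    qed
  qed
  ultimately have "(\<lambda>m. (eulerian m (cis (\<theta> m)) / fact m - u m) * cis (- \<theta> m * m / 2)) \<longlonglongrightarrow> 0"
    by (rule Lim_null_comparison[rotated])
  from tendsto_add[OF this main] show ?thesis by (simp add: algebra_simps \<theta>_def)
qed

text \<open>The function \<open>cos y * exp (y^2 / 2)\<close> decreases from 1 on the positive side,
  because \<open>y * cos y <= sin y\<close>; evenness covers negative \<open>x\<close>.\<close>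

lemma cos_le_exp:
  fixes x :: real
  assumes "\<bar>x\<bar> \<le> pi / 2"
  shows "cos x \<le> exp (- x\<^sup>2 / 2)"
proof -
  have sin_ge: "y * cos y \<le> sin y" if "0 \<le> y" "y \<le> pi" for y :: real
  proof -
    have "sin 0 - 0 * cos 0 \<le> sin y - y * cos y"
      using that by (intro DERIV_nonneg_imp_nondecreasing[where f = "\<lambda>y. sin y - y * cos y"])
        (auto intro!: exI[of _ "_ * sin _"] derivative_eq_intros mult_nonneg_nonneg sin_ge_zero)
    then show ?thesis by simp
  qed
  have "cos \<bar>x\<bar> * exp (\<bar>x\<bar>\<^sup>2 / 2) \<le> cos 0 * exp (0\<^sup>2 / 2)"
  proof (rule DERIV_nonpos_imp_nonincreasing[where f = "\<lambda>y. cos y * exp (y\<^sup>2 / 2)"])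
    fix y assume y: "0 \<le> y" "y \<le> \<bar>x\<bar>"
    have "((\<lambda>y. cos y * exp (y\<^sup>2 / 2)) has_real_derivative (y * cos y - sin y) * exp (y\<^sup>2 / 2)) (at y)"
      by (auto intro!: derivative_eq_intros simp: algebra_simps)
    moreover have "(y * cos y - sin y) * exp (y\<^sup>2 / 2) \<le> 0"
      using sin_ge[of y] y assms by (intro mult_nonpos_nonneg) auto
    ultimately show "\<exists>D. ((\<lambda>y. cos y * exp (y\<^sup>2 / 2)) has_real_derivative D) (at y) \<and> D \<le> 0" by blast
  qed simp
  then show ?thesis by (simp add: exp_minus field_simps)
qed

section \<open>Gaussian integrals and rescaled Fourier coefficients\<close>

lemma gaussian_integral:
  fixes \<sigma> :: real
  assumes "\<sigma> > 0"
  shows "integrable lborel (\<lambda>x. exp (- x\<^sup>2 / (2 * \<sigma>\<^sup>2)))"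
    and "(LINT x|lborel. exp (- x\<^sup>2 / (2 * \<sigma>\<^sup>2))) = sqrt (2 * pi * \<sigma>\<^sup>2)"
proof -
  have eq: "(\<lambda>x. exp (- x\<^sup>2 / (2 * \<sigma>\<^sup>2))) = (\<lambda>x. sqrt (2 * pi * \<sigma>\<^sup>2) * normal_density 0 \<sigma> x)"
    using assms by (simp add: normal_density_def)
  show "integrable lborel (\<lambda>x. exp (- x\<^sup>2 / (2 * \<sigma>\<^sup>2)))"
    and "(LINT x|lborel. exp (- x\<^sup>2 / (2 * \<sigma>\<^sup>2))) = sqrt (2 * pi * \<sigma>\<^sup>2)"
    unfolding eq using assms by simp_all
qed

text \<open>The \<open>k\<close>-th summand of \<open>sum_permutes_fix_exc\<close> at
  \<open>z = cis \<theta>\<close> with \<open>m = n - k\<close>, without its sign and binomial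
  coefficient, and divided by \<open>2 ^ m * fact m\<close> so that its modulus is at most
  1.\<close>

definition fourier_integrand :: "nat \<Rightarrow> nat \<Rightarrow> real \<Rightarrow> complex" where
  "fourier_integrand m k \<theta> =
     eulerian m (cis \<theta>) / fact m * ((1 + 1 / cis \<theta>) / 2) ^ m * (1 / cis \<theta>) ^ k"

definition fourier_coeff :: "nat \<Rightarrow> nat \<Rightarrow> complex" where
  "fourier_coeff m k = (LINT \<theta>|lborel. indicator {-pi..pi} \<theta> *\<^sub>R fourier_integrand m k \<theta>)"

lemma half_one_plus_inverse_cis:
  "(1 + 1 / cis \<theta>) / 2 = cis (- \<theta> / 2) * of_real (cos (\<theta> / 2))"
proof -
  have a: "cis (- \<theta> / 2) * cis (\<theta> / 2) = 1"
    by (simp add: cis_mult)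
  have b: "cis (- \<theta> / 2) * cis (- \<theta> / 2) = 1 / cis \<theta>"
    unfolding cis_mult inverse_eq_divide[symmetric] cis_inverse by (rule arg_cong[of _ _ cis]) simp
  have "1 + 1 / cis \<theta> = cis (- \<theta> / 2) * (cis (\<theta> / 2) + cis (- \<theta> / 2))"
    by (simp only: distrib_left a b)
  also have "cis (\<theta> / 2) + cis (- \<theta> / 2) = 2 * of_real (cos (\<theta> / 2))"
    by (simp add: complex_eq_iff)
  finally show ?thesis by simp
qed

text \<open>The half-angle phase of \<open>1 + 1 / cis \<theta>\<close> is exactly the centring
  needed in \<open>eulerian_cis_tendsto\<close>.\<close>

lemma fourier_integrand_eq:
  "fourier_integrand m k \<theta> =
     (eulerian m (cis \<theta>) / fact m * cis (- \<theta> * m / 2)) * of_real (cos (\<theta> / 2) ^ m) * cis (- (k * \<theta>))"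
proof -
  have 1: "cis (- \<theta> / 2) ^ m = cis (- \<theta> * m / 2)"
    unfolding Complex.DeMoivre by (simp add: mult.commute)
  have 2: "(1 / cis \<theta>) ^ k = cis (- (k * \<theta>))"
    by (simp add: Complex.DeMoivre cis_inverse divide_inverse)
  show ?thesis
    unfolding fourier_integrand_def half_one_plus_inverse_cis power_mult_distrib 1 2 of_real_power
    by (simp only: mult.assoc)
qed

text \<open>All the decay comes from the cosine factor, hence the bound is uniform in
  \<open>k\<close>.\<close>

lemma norm_fourier_integrand_le:
  assumes "\<bar>\<theta>\<bar> \<le> pi"
  shows "norm (fourier_integrand m k \<theta>) \<le> exp (- (m * \<theta>\<^sup>2 / 8))"
proof -
  have "0 \<le> cos (\<theta> / 2)" using assms by (intro cos_ge_zero) auto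
  have "norm (fourier_integrand m k \<theta>) = norm (eulerian m (cis \<theta>)) / fact m * cos (\<theta> / 2) ^ m"
    using \<open>0 \<le> cos (\<theta> / 2)\<close> by (simp add: fourier_integrand_eq norm_mult norm_divide norm_power)
  also have "\<dots> \<le> 1 * exp (- (\<theta> / 2)\<^sup>2 / 2) ^ m"
    using assms \<open>0 \<le> cos (\<theta> / 2)\<close> norm_eulerian_cis_le[of m \<theta>]
    by (intro mult_mono power_mono cos_le_exp) auto
  also have "\<dots> = exp (- (m * \<theta>\<^sup>2 / 8))"
    by (simp add: power2_eq_square flip: exp_of_nat_mult)
  finally show ?thesis .
qed

lemma continuous_on_fourier_integrand: "continuous_on A (fourier_integrand m k)"
  unfolding fourier_integrand_def eulerian_def by (intro continuous_intros) auto

lemma measurable_fourier_integrand [measurable]: "fourier_integrand m k \<in> borel_measurable borel"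
  by (rule borel_measurable_continuous_onI) (rule continuous_on_fourier_integrand)

lemma sqrt_fourier_coeff:
  assumes "m > 0"
  shows "sqrt m * fourier_coeff m k =
    (LINT t|lborel. indicator {-pi..pi} (t / sqrt m) *\<^sub>R fourier_integrand m k (t / sqrt m))"
  using assms unfolding fourier_coeff_def
  by (subst lborel_integral_real_affine[of "1 / sqrt m" _ 0]) (auto simp: scaleR_conv_of_real)

lemma norm_rescaled_integrand_le:
  assumes "m > 0"
  shows "norm (indicator {-pi..pi} (t / sqrt m) *\<^sub>R fourier_integrand m k (t / sqrt m)) \<le> exp (- t\<^sup>2 / (2 * 2\<^sup>2))"
  using norm_fourier_integrand_le[of "t / sqrt m" m k] assms
  by (auto simp: indicator_def power_divide abs_le_iff)

lemma norm_sqrt_fourier_coeff_le: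
  "norm (sqrt m * fourier_coeff m k) \<le> sqrt (8 * pi)"
proof (cases "m > 0")
  case True
  have "norm (sqrt m * fourier_coeff m k) \<le> (LINT t|lborel. exp (- t\<^sup>2 / (2 * 2\<^sup>2)))"
    unfolding sqrt_fourier_coeff[OF True]
    by (rule Bochner_Integration.integral_norm_bound_integral)
      (auto simp: gaussian_integral(1)[of 2, simplified] norm_rescaled_integrand_le[OF True, simplified]
        intro!: Bochner_Integration.integrable_bound[OF gaussian_integral(1)[of 2]])
  then show ?thesis using gaussian_integral(2)[of 2] by simp
qed simp

text \<open>Dominated convergence after the substitution \<open>\<theta> = t / sqrt m\<close>. The
  limit exponents add up as 1/24 + 1/8 = 1/6, a Gaussian of variance 3.\<close>

lemma sqrt_fourier_coeff_tendsto:
  "(\<lambda>m. sqrt m * fourier_coeff m k) \<longlonglongrightarrow> of_real (sqrt (6 * pi))"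
proof -
  \<comment> \<open>The shift to \<open>Suc m\<close> avoids index 0, where the dominating function
    fails.\<close>
  let ?g = "\<lambda>m t. indicator {-pi..pi} (t / sqrt (Suc m)) *\<^sub>R fourier_integrand (Suc m) k (t / sqrt (Suc m))"
  let ?l = "\<lambda>t. complex_of_real (exp (- t\<^sup>2 / (2 * (sqrt 3)\<^sup>2)))"
  have lim: "(\<lambda>m. indicator {-pi..pi} (t / sqrt m) *\<^sub>R fourier_integrand m k (t / sqrt m)) \<longlonglongrightarrow> ?l t" for t
  proof -
    have z: "(\<lambda>m. t / sqrt (real m)) \<longlonglongrightarrow> 0" by real_asymp
    have "\<forall>\<^sub>F m in sequentially. \<bar>t / sqrt (real m)\<bar> < pi"
      using tendstoD[OF z, of pi] by (simp add: dist_norm)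
    then have ind: "\<forall>\<^sub>F m in sequentially. fourier_integrand m k (t / sqrt m) = indicator {-pi..pi} (t / sqrt m) *\<^sub>R fourier_integrand m k (t / sqrt m)"
    proof eventually_elim
      case (elim m)
      then have "t / sqrt m \<in> {-pi..pi}" by (simp only: abs_less_iff atLeastAtMost_iff) linarith
      then show ?case by simp
    qed
    have "(\<lambda>m. cis (- (k * (t / sqrt (real m))))) \<longlonglongrightarrow> cis (- (real k * 0))"
      by (intro tendsto_intros z)
    then have "(\<lambda>m. fourier_integrand m k (t / sqrt m)) \<longlonglongrightarrow>
        of_real (exp (- t\<^sup>2 / 24)) * of_real (exp (- t\<^sup>2 / 8)) * cis (- (real k * 0))"
      unfolding fourier_integrand_eq
      by (intro tendsto_mult eulerian_cis_tendsto tendsto_of_real cos_power_tendsto)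
    moreover have "complex_of_real (exp (- t\<^sup>2 / 24)) * of_real (exp (- t\<^sup>2 / 8)) * cis (- (real k * 0)) = ?l t"
      by (simp add: field_simps flip: exp_add of_real_mult)
    ultimately show ?thesis using Lim_transform_eventually ind by fastforce
  qed
  have "(\<lambda>m. LINT t|lborel. ?g m t) \<longlonglongrightarrow> (LINT t|lborel. ?l t)"
  proof (rule integral_dominated_convergence)
    show "integrable lborel (\<lambda>t. exp (- t\<^sup>2 / (2 * 2\<^sup>2)) :: real)" by (rule gaussian_integral) simp
    show "AE t in lborel. (\<lambda>m. ?g m t) \<longlonglongrightarrow> ?l t"
      by (intro AE_I2 LIMSEQ_Suc[OF lim])
    show "AE t in lborel. norm (?g m t) \<le> exp (- t\<^sup>2 / (2 * 2\<^sup>2))" for m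
      by (intro AE_I2 norm_rescaled_integrand_le) simp
  qed measurable
  moreover have "(LINT t|lborel. ?l t) = of_real (sqrt (6 * pi))"
    using gaussian_integral(2)[of "sqrt 3"] by (subst integral_complex_of_real) simp
  ultimately have "(\<lambda>m. sqrt (Suc m) * fourier_coeff (Suc m) k) \<longlonglongrightarrow> of_real (sqrt (6 * pi))"
    by (simp only: sqrt_fourier_coeff zero_less_Suc)
  then show ?thesis by (rule LIMSEQ_imp_Suc)
qed

subsection \<open>Reduction modulo n\<close>

text \<open>Complementing \<open>S\<close> inside \<open>U - E\<close> and keeping it inside
  \<open>E\<close> is an involution; it turns balance into having size
  \<open>card (U - E)\<close>.\<close>

lemma card_balanced_subsets:
  assumes "finite U" "E \<subseteq> U"
  shows "card {S. S \<subseteq> U \<and> card (S \<inter> E) = card (S - E)} = card U choose card (U - E)"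
proof -
  let ?D = "U - E" and ?f = "\<lambda>S. (S \<inter> E) \<union> ((U - E) - S)"
  have card_f: "card (?f S) + card (S - E) = card (S \<inter> E) + card ?D" if "S \<subseteq> U" for S
  proof -
    have fin: "finite S" using that assms finite_subset by blast
    have "card (?f S) = card (S \<inter> E) + card (?D - S)"
      using fin assms by (intro card_Un_disjoint) auto
    moreover have "card ?D = card (S - E) + card (?D - S)"
      using fin assms that by (subst card_Un_disjoint[symmetric]) (auto intro!: arg_cong[of _ _ card])
    ultimately show ?thesis by simp
  qed
  have "bij_betw ?f {S. S \<subseteq> U \<and> card (S \<inter> E) = card (S - E)} {T. T \<subseteq> U \<and> card T = card ?D}"
  proof (rule bij_betw_byWitness[where f' = ?f])
    show "?f ` {S. S \<subseteq> U \<and> card (S \<inter> E) = card (S - E)} \<subseteq> {T. T \<subseteq> U \<and> card T = card ?D}"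
      using assms card_f by auto (metis add_right_cancel add.commute)
    show "?f ` {T. T \<subseteq> U \<and> card T = card ?D} \<subseteq> {S. S \<subseteq> U \<and> card (S \<inter> E) = card (S - E)}"
    proof (intro image_subsetI CollectI conjI)
      fix T assume T: "T \<in> {T. T \<subseteq> U \<and> card T = card ?D}"
      then show "?f T \<subseteq> U" using assms by auto
      have "?f T \<inter> E = T \<inter> E" "?f T - E = ?D - T" by auto
      moreover have "finite T" using T assms finite_subset by blast
      then have "card T = card (T \<inter> E) + card (T - E)"
        by (subst card_Un_disjoint[symmetric]) (auto intro!: arg_cong[of _ _ card])
      moreover have "card ?D = card (T - E) + card (?D - T)"
        using \<open>finite T\<close> assms T by (subst card_Un_disjoint[symmetric]) (auto intro!: arg_cong[of _ _ card])
      ultimately show "card (?f T \<inter> E) = card (?f T - E)" using T by simp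
    qed
  qed (use assms in auto)
  then have "card {S. S \<subseteq> U \<and> card (S \<inter> E) = card (S - E)} = card {T. T \<subseteq> U \<and> card T = card ?D}"
    by (rule bij_betw_same_card)
  then show ?thesis using assms(1) by (simp add: n_subsets)
qed

text \<open>
  A bounded affine permutation satisfies \<open>\<sigma> i = p i + n * wrap p S i\<close> for \<open>0 \<le> i < n\<close>; by boundedness
  the sign of the wrap is forced by whether \<open>i\<close> is an exceedance of \<open>p\<close>.
\<close>

definition wrap :: "(nat \<Rightarrow> nat) \<Rightarrow> nat set \<Rightarrow> nat \<Rightarrow> int" where
  "wrap p S i = (if i \<in> S then if i < p i then -1 else 1 else 0)"

definition unfold_perm :: "nat \<Rightarrow> (nat \<Rightarrow> nat) \<times> nat set \<Rightarrow> int \<Rightarrow> int" where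
  "unfold_perm n = (\<lambda>(p, S) x. int (p (nat (x mod int n))) +
     int n * (x div int n + wrap p S (nat (x mod int n))))"

text \<open>Equal cardinalities make the wraps sum to zero, as the sum condition demands. Fixed
  points are excluded since wrapping one would displace it by exactly \<open>n\<close>.\<close>

definition wrapped_perms :: "nat \<Rightarrow> ((nat \<Rightarrow> nat) \<times> nat set) set" where
  "wrapped_perms n = (SIGMA p:{p. p permutes {..<n}}.
     {S. S \<subseteq> {i\<in>{..<n}. p i \<noteq> i} \<and> card (S \<inter> exc {..<n} p) = card (S - exc {..<n} p)})"

section \<open>The bijection with permutations carrying a balanced wrapped set\<close>

lemma sum_wrap:
  assumes "S \<subseteq> {..<n}"
  shows "(\<Sum>i<n. wrap p S i) = int (card (S - exc {..<n} p)) - int (card (S \<inter> exc {..<n} p))"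
proof -
  have fin: "finite S" using assms finite_subset by blast
  have "(\<Sum>i<n. wrap p S i) = (\<Sum>i\<in>S. wrap p S i)"
    using assms by (intro sum.mono_neutral_right) (auto simp: wrap_def)
  also have "\<dots> = (\<Sum>i\<in>S - exc {..<n} p. wrap p S i) + (\<Sum>i\<in>S \<inter> exc {..<n} p. wrap p S i)"
    using fin by (subst sum.union_disjoint[symmetric]) (auto intro!: sum.cong)
  also have "(\<Sum>i\<in>S - exc {..<n} p. wrap p S i) = (\<Sum>i\<in>S - exc {..<n} p. 1)"
    using assms by (intro sum.cong) (auto simp: wrap_def exc_def)
  also have "(\<Sum>i\<in>S \<inter> exc {..<n} p. wrap p S i) = (\<Sum>i\<in>S \<inter> exc {..<n} p. -1)"
    by (intro sum.cong) (auto simp: wrap_def exc_def)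
  finally show ?thesis by simp
qed

text \<open>Displacement is periodic, so the window \<open>1..n\<close> may be moved to
  \<open>0..n-1\<close>, the domain of \<open>p\<close>.\<close>

lemma sum_displacement:
  fixes \<sigma> :: "int \<Rightarrow> int"
  assumes "\<And>i. \<sigma> (i + int n) = \<sigma> i + int n"
  shows "(\<Sum>i = 1..int n. \<sigma> i) - (\<Sum>i = 1..int n. i) = (\<Sum>i<n. \<sigma> (int i) - int i)"
proof -
  let ?d = "\<lambda>i. \<sigma> i - i"
  have "(\<Sum>i = 1..int n. \<sigma> i) - (\<Sum>i = 1..int n. i) = (\<Sum>i\<in>int ` {1..n}. ?d i)"
    by (simp add: sum_subtractf image_int_atLeastAtMost)
  also have "\<dots> = (\<Sum>i=1..n. ?d (int i))"
    by (subst sum.reindex) simp_all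
  also have "\<dots> = (\<Sum>i<n. ?d (int (Suc i)))"
    by (simp add: sum.atLeast1_atMost_eq)
  also have "\<dots> = (\<Sum>i<n. ?d (int i)) + (?d (int n) - ?d (int 0))"
  proof -
    have "(\<Sum>i<n. ?d (int (Suc i))) - (\<Sum>i<n. ?d (int i)) = ?d (int n) - ?d (int 0)"
      unfolding sum_subtractf[symmetric] by (rule sum_lessThan_telescope)
    then show ?thesis by linarith
  qed
  also have "?d (int n) - ?d (int 0) = 0" using assms[of 0] by simp
  finally show ?thesis by simp
qed

lemma unfold_perm_of_nat:
  assumes "i < n" "p permutes {..<n}"
  shows "unfold_perm n (p, S) (int i) = int (p i) + int n * wrap p S i"
  using assms by (simp add: unfold_perm_def)

text \<open>Remainder and quotient by \<open>n\<close> recover \<open>p\<close> and the wrap, which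
  gives bijectivity. The bound holds because a wrap opposes the nonzero displacement
  \<open>p i - i\<close>.\<close>

lemma unfold_perm_mem:
  assumes n: "n > 0" and pS: "(p, S) \<in> wrapped_perms n"
  shows "unfold_perm n (p, S) \<in> bounded_affine_permutations n"
proof -
  let ?\<sigma> = "unfold_perm n (p, S)"
  have p: "p permutes {..<n}" and S: "S \<subseteq> {i\<in>{..<n}. p i \<noteq> i}"
    and bal: "card (S \<inter> exc {..<n} p) = card (S - exc {..<n} p)"
    using pS by (auto simp: wrapped_perms_def)
  define r where "r x = nat (x mod int n)" for x
  have r: "r x < n" "int (r x) = x mod int n" for x using n by (auto simp: r_def nat_less_iff)
  have pr: "p i < n" if "i < n" for i using permutes_in_image[OF p, of i] that by simp
  have \<sigma>: "?\<sigma> x = int (p (r x)) + int n * (x div int n + wrap p S (r x))" for x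
    by (simp add: unfold_perm_def r_def)
  have decomp: "x = int (r x) + int n * (x div int n)" for x using r(2) by simp
  have periodic: "?\<sigma> (x + int n) = ?\<sigma> x + int n" for x
    using n by (simp add: \<sigma> r_def algebra_simps)
  have mod: "?\<sigma> x mod int n = int (p (r x))" and dv: "?\<sigma> x div int n = x div int n + wrap p S (r x)" for x
    using pr[OF r(1)[of x]] by (simp_all add: \<sigma>)
  have "inj ?\<sigma>"
  proof (rule injI)
    fix x y assume eq: "?\<sigma> x = ?\<sigma> y"
    have "p (r x) = p (r y)" using mod[of x] mod[of y] eq by simp
    then have rr: "r x = r y" using permutes_inj[OF p] by (simp add: inj_eq)
    moreover have "x div int n = y div int n" using dv[of x] dv[of y] eq rr by simp
    ultimately show "x = y" using decomp by metis
  qed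
  moreover have "surj ?\<sigma>"
  proof -
    have "\<exists>x. y = ?\<sigma> x" for y
    proof
    define i where "i = inv p (r y)"
    have i: "p i = r y" unfolding i_def using permutes_inverses[OF p] by simp
    then have "i < n" using permutes_in_image[OF p, of i] r(1) by simp
    then show "y = ?\<sigma> (int i + int n * (y div int n - wrap p S i))"
      using i decomp[of y] by (simp add: \<sigma> r_def)
    qed
    then show ?thesis by (auto simp: surj_def)
  qed
  moreover have "(\<Sum>i = 1..int n. ?\<sigma> i) = (\<Sum>i = 1..int n. i)"
  proof -
    have "(\<Sum>i<n. ?\<sigma> (int i) - int i) = (\<Sum>i<n. int (p i)) - (\<Sum>i<n. int i) + int n * (\<Sum>i<n. wrap p S i)"
      by (simp add: unfold_perm_of_nat[OF _ p] sum_subtractf sum.distrib sum_distrib_left)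
    also have "(\<Sum>i<n. int (p i)) = (\<Sum>i<n. int i)"
      using sum.permute[OF p, of int] by (simp add: o_def)
    also have "(\<Sum>i<n. wrap p S i) = 0" using S bal by (subst sum_wrap) auto
    finally show ?thesis using sum_displacement[of ?\<sigma> n, OF periodic] by simp
  qed
  moreover have "\<bar>?\<sigma> x - x\<bar> < int n" for x
  proof -
    have "?\<sigma> x - x = int (p (r x)) - int (r x) + int n * wrap p S (r x)"
      using decomp[of x] by (simp add: \<sigma> algebra_simps)
    then show ?thesis using r(1)[of x] pr[OF r(1)[of x]] S by (auto simp: wrap_def)
  qed
  ultimately show ?thesis
    using periodic by (simp add: bounded_affine_permutations_def affine_permutation_def bij_def)
qed

lemma inj_on_unfold_perm:
  assumes "n > 0"
  shows "inj_on (unfold_perm n) (wrapped_perms n)"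
proof (rule inj_onI, clarify)
  fix p S p' S'
  assume pS: "(p, S) \<in> wrapped_perms n" and pS': "(p', S') \<in> wrapped_perms n"
    and eq: "unfold_perm n (p, S) = unfold_perm n (p', S')"
  have p: "p permutes {..<n}" "S \<subseteq> {..<n}" and p': "p' permutes {..<n}" "S' \<subseteq> {..<n}"
    using pS pS' by (auto simp: wrapped_perms_def)
  have *: "p i = p' i \<and> wrap p S i = wrap p' S' i" if i: "i < n" for i
  proof -
    have lt: "p i < n" "p' i < n"
      using permutes_in_image[OF p(1), of i] permutes_in_image[OF p'(1), of i] i by auto
    have e: "int (p i) + int n * wrap p S i = int (p' i) + int n * wrap p' S' i"
      using fun_cong[OF eq, of "int i"] i by (simp add: unfold_perm_of_nat[OF _ p(1)] unfold_perm_of_nat[OF _ p'(1)])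
    show ?thesis
      using arg_cong[OF e, of "\<lambda>x. x mod int n"] arg_cong[OF e, of "\<lambda>x. x div int n"] lt by simp
  qed
  have "p = p'"
    using * p(1) p'(1) by (metis ext lessThan_iff permutes_not_in)
  moreover have "i \<in> S \<longleftrightarrow> i \<in> S'" for i
    using *[of i] p(2) p'(2) by (cases "i < n") (auto simp: wrap_def split: if_splits)
  ultimately show "p = p' \<and> S = S'" by blast
qed

text \<open>Take remainders of \<sigma> on \<open>0..n-1\<close> for \<open>p\<close>, and for
  \<open>S\<close> the points with nonzero quotient.\<close>

lemma bounded_affine_permutation_unfold:
  assumes n: "n > 0" and \<sigma>: "\<sigma> \<in> bounded_affine_permutations n"
  shows "\<sigma> \<in> unfold_perm n ` wrapped_perms n"
proof -
  have inj: "inj \<sigma>" and periodic: "\<And>i. \<sigma> (i + int n) = \<sigma> i + int n"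
    and sum: "(\<Sum>i = 1..int n. \<sigma> i) = (\<Sum>i = 1..int n. i)"
    and bd: "\<And>i. \<bar>\<sigma> i - i\<bar> < int n"
    using \<sigma> by (auto simp: bounded_affine_permutations_def affine_permutation_def bij_def)
  have per: "\<sigma> (x + int n * k) = \<sigma> x + int n * k" for x k
  proof (induction k rule: int_induct[where k = 0])
    case (step1 i)
    then show ?case using periodic[of "x + int n * i"] by (simp add: algebra_simps)
  next
    case (step2 i)
    then show ?case using periodic[of "x + int n * (i - 1)"] by (simp add: algebra_simps)
  qed simp
  define p where "p i = (if i < n then nat (\<sigma> (int i) mod int n) else i)" for i
  define S where "S = {i\<in>{..<n}. \<sigma> (int i) div int n \<noteq> 0}"
  have pi: "int (p i) = \<sigma> (int i) mod int n" "p i < n" if "i < n" for i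
    using that n by (auto simp: p_def nat_less_iff)
  \<comment> \<open>Values congruent modulo \<open>n\<close> come from congruent arguments, by
    periodicity and injectivity of \<sigma>.\<close>
  have "inj_on p {..<n}"
  proof (rule inj_onI)
    fix i j assume ij: "i \<in> {..<n}" "j \<in> {..<n}" "p i = p j"
    then have "\<sigma> (int i) mod int n = \<sigma> (int j) mod int n" using pi by (metis lessThan_iff)
    then obtain k where "\<sigma> (int i) - \<sigma> (int j) = int n * k" by (auto simp: mod_eq_dvd_iff)
    then have "\<sigma> (int i) = \<sigma> (int j + int n * k)" unfolding per by linarith
    then have "int i = int j + int n * k" using inj by (simp add: inj_eq)
    then have "int i mod int n = int j mod int n" by simp
    then show "i = j" using ij by simp
  qed
  moreover from this have "p ` {..<n} = {..<n}"
    by (intro endo_inj_surj) (use pi(2) in auto)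
  ultimately have p: "p permutes {..<n}"
    by (intro bij_imp_permutes) (auto simp: p_def bij_betw_def)
  have split: "\<sigma> (int i) = int (p i) + int n * (\<sigma> (int i) div int n)" if "i < n" for i
    using pi[OF that] by simp
  have wrap: "\<sigma> (int i) div int n = wrap p S i" if i: "i < n" for i
  proof -
    define c where "c = \<sigma> (int i) div int n"
    have inS: "i \<in> S \<longleftrightarrow> c \<noteq> 0" using i by (simp add: S_def c_def)
    have s: "\<sigma> (int i) = int (p i) + int n * c" unfolding c_def by (rule split[OF i])
    \<comment> \<open>The bound leaves only the quotients -1, 0 and 1; a nonzero one must oppose
      \<open>p i - i\<close>, which matches \<open>wrap\<close>.\<close>
    have "int n * c < int n * 2" "int n * (- 2) < int n * c" using s bd[of "int i"] pi(2)[OF i] i by linarith+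
    then have "c < 2" "-2 < c" using n by (simp_all only: mult_less_cancel_left_pos of_nat_0_less_iff)
    then consider "c = -1" | "c = 0" | "c = 1" by linarith
    then show ?thesis
      unfolding c_def[symmetric] using s bd[of "int i"] by cases (auto simp: wrap_def inS)
  qed
  have S: "S \<subseteq> {i\<in>{..<n}. p i \<noteq> i}"
  proof
    fix i assume i: "i \<in> S"
    then have "i < n" "\<sigma> (int i) div int n \<noteq> 0" by (auto simp: S_def)
    moreover have "p i \<noteq> i"
    proof
      assume "p i = i"
      then have "\<bar>int n * (\<sigma> (int i) div int n)\<bar> < int n" using split[OF \<open>i < n\<close>] bd[of "int i"] by linarith
      then show False using calculation n by (simp add: abs_mult)
    qed
    ultimately show "i \<in> {i\<in>{..<n}. p i \<noteq> i}" by simp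
  qed
  have "0 = (\<Sum>i<n. \<sigma> (int i) - int i)"
    using sum_displacement[of \<sigma> n, OF periodic] sum by simp
  also have "\<dots> = (\<Sum>i<n. int (p i) - int i + int n * wrap p S i)"
    by (intro sum.cong refl) (use split wrap in \<open>simp add: algebra_simps\<close>)
  also have "\<dots> = (\<Sum>i<n. int (p i)) - (\<Sum>i<n. int i) + int n * (\<Sum>i<n. wrap p S i)"
    by (simp add: sum_subtractf sum.distrib sum_distrib_left)
  also have "(\<Sum>i<n. int (p i)) = (\<Sum>i<n. int i)"
    using sum.permute[OF p, of int] by (simp add: o_def)
  finally have "(\<Sum>i<n. wrap p S i) = 0" using n by simp
  then have "card (S \<inter> exc {..<n} p) = card (S - exc {..<n} p)"
    using S by (subst (asm) sum_wrap) auto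
  then have "(p, S) \<in> wrapped_perms n" using p S by (simp add: wrapped_perms_def)
  moreover have "\<sigma> = unfold_perm n (p, S)"
  proof
    fix x
    define i where "i = nat (x mod int n)"
    have i: "i < n" "int i = x mod int n" using n by (auto simp: i_def nat_less_iff)
    then have "\<sigma> x = \<sigma> (int i) + int n * (x div int n)" using per[of "int i" "x div int n"] by simp
    also have "\<dots> = unfold_perm n (p, S) x"
      using split[OF i(1)] wrap[OF i(1)] by (simp add: unfold_perm_def algebra_simps flip: i_def)
    finally show "\<sigma> x = unfold_perm n (p, S) x" .
  qed
  ultimately show ?thesis by blast
qed

lemma card_bounded_affine_permutations:
  assumes n: "n > 0"
  shows "card (bounded_affine_permutations n) =
    (\<Sum>p | p permutes {..<n}. (n - card {i\<in>{..<n}. p i = i}) choose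
       (n - card {i\<in>{..<n}. p i = i} - card (exc {..<n} p)))"
proof -
  have "bounded_affine_permutations n = unfold_perm n ` wrapped_perms n"
    using bounded_affine_permutation_unfold[OF n] unfold_perm_mem[OF n] by auto
  then have "card (bounded_affine_permutations n) = card (wrapped_perms n)"
    using inj_on_unfold_perm[OF n] by (simp add: card_image)
  also have "\<dots> = (\<Sum>p | p permutes {..<n}. card {S. S \<subseteq> {i\<in>{..<n}. p i \<noteq> i} \<and>
      card (S \<inter> exc {..<n} p) = card (S - exc {..<n} p)})"
    unfolding wrapped_perms_def by (intro card_SigmaI) (auto simp: finite_permutations)
  also have "\<dots> = (\<Sum>p | p permutes {..<n}. (n - card {i\<in>{..<n}. p i = i}) choose
       (n - card {i\<in>{..<n}. p i = i} - card (exc {..<n} p)))"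
  proof (intro sum.cong refl)
    fix p
    let ?U = "{i\<in>{..<n}. p i \<noteq> i}"
    have U: "?U = {..<n} - {i\<in>{..<n}. p i = i}" by auto
    have cU: "card ?U = n - card {i\<in>{..<n}. p i = i}" unfolding U by (subst card_Diff_subset) auto
    have sub: "exc {..<n} p \<subseteq> ?U" by (auto simp: exc_def)
    then have "card (?U - exc {..<n} p) = card ?U - card (exc {..<n} p)"
      by (intro card_Diff_subset) auto
    then show "card {S. S \<subseteq> ?U \<and> card (S \<inter> exc {..<n} p) = card (S - exc {..<n} p)} =
        (n - card {i\<in>{..<n}. p i = i}) choose (n - card {i\<in>{..<n}. p i = i} - card (exc {..<n} p))"
      using card_balanced_subsets[OF _ sub] cU by simp
  qed
  finally show ?thesis .
qed

subsection \<open>The asymptotic count\<close>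

lemma has_integral_cis_period:
  "has_bochner_integral lborel (\<lambda>\<theta>. indicator {-pi..pi} \<theta> *\<^sub>R cis (of_int l * \<theta>))
     (if l = 0 then of_real (2 * pi) else 0)"
proof (cases "l = 0")
  case True
  have "has_bochner_integral lborel (\<lambda>\<theta>. indicator {-pi..pi} \<theta> *\<^sub>R (1::complex))
      (of_real pi - of_real (- pi))"
    by (rule has_bochner_integral_FTC_Icc) (auto intro!: derivative_eq_intros)
  then show ?thesis using True by simp
next
  case False
  have "has_bochner_integral lborel (\<lambda>\<theta>. indicator {-pi..pi} \<theta> *\<^sub>R cis (of_int l * \<theta>))
      (cis (of_int l * pi) / (\<i> * of_int l) - cis (of_int l * (- pi)) / (\<i> * of_int l))"
  proof (rule has_bochner_integral_FTC_Icc)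
    fix \<theta> :: real
    have "((\<lambda>x. exp (\<i> * of_int l * x) / (\<i> * of_int l)) has_field_derivative
        exp (\<i> * of_int l * of_real \<theta>)) (at (of_real \<theta>))"
      using False by (auto intro!: derivative_eq_intros)
    then show "((\<lambda>\<theta>. cis (of_int l * \<theta>) / (\<i> * of_int l)) has_vector_derivative cis (of_int l * \<theta>))
        (at \<theta> within {-pi..pi})"
      using has_vector_derivative_real_field by (fastforce simp: cis_conv_exp mult.assoc)
  qed (auto intro!: continuous_intros)
  moreover have "cis (of_int l * pi) = cis (of_int l * (- pi))"
    by (simp add: complex_eq_iff sin_times_pi_eq_0)
  ultimately show ?thesis using False by simp
qed

text \<open>The integrand is \<open>(1 + z) ^ (e + d) * z ^ (-d)\<close> on the circle; only its
  constant term survives integration.\<close>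

lemma has_integral_binomial:
  "has_bochner_integral lborel
     (\<lambda>\<theta>. indicator {-pi..pi} \<theta> *\<^sub>R ((1 + cis \<theta>) ^ e * (1 + 1 / cis \<theta>) ^ d))
     (of_real (2 * pi) * of_nat ((e + d) choose d))"
proof -
  have "(1 + cis \<theta>) ^ e * (1 + 1 / cis \<theta>) ^ d =
      (\<Sum>i\<le>e + d. of_nat ((e + d) choose i) * cis (of_int (int i - int d) * \<theta>))" for \<theta>
  proof -
    have "1 + 1 / cis \<theta> = (1 + cis \<theta>) * cis (- \<theta>)"
      by (simp add: distrib_right cis_mult flip: cis_inverse) (simp add: inverse_eq_divide)
    then have "(1 + cis \<theta>) ^ e * (1 + 1 / cis \<theta>) ^ d = (1 + cis \<theta>) ^ (e + d) * cis (- \<theta>) ^ d"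
      by (simp add: power_mult_distrib power_add)
    also have "\<dots> = (\<Sum>i\<le>e + d. of_nat ((e + d) choose i) * cis \<theta> ^ i) * cis (- \<theta>) ^ d"
      by (simp add: binomial_ring[of "cis \<theta>" 1, simplified] add.commute[of 1])
    also have "\<dots> = (\<Sum>i\<le>e + d. of_nat ((e + d) choose i) * cis (of_int (int i - int d) * \<theta>))"
      unfolding sum_distrib_right Complex.DeMoivre mult.assoc cis_mult
      by (intro sum.cong refl) (simp add: algebra_simps)
    finally show ?thesis .
  qed
  then have eq: "(\<lambda>\<theta>. indicator {-pi..pi} \<theta> *\<^sub>R ((1 + cis \<theta>) ^ e * (1 + 1 / cis \<theta>) ^ d)) =
      (\<lambda>\<theta>. \<Sum>i\<le>e + d. of_nat ((e + d) choose i) * (indicator {-pi..pi} \<theta> *\<^sub>R cis (of_int (int i - int d) * \<theta>)))"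
    by (simp add: scaleR_sum_right)
  have "has_bochner_integral lborel (\<lambda>\<theta>. \<Sum>i\<le>e + d. of_nat ((e + d) choose i) * (indicator {-pi..pi} \<theta> *\<^sub>R cis (of_int (int i - int d) * \<theta>)))
      (\<Sum>i\<le>e + d. of_nat ((e + d) choose i) * (if int i - int d = 0 then of_real (2 * pi) else 0))"
    by (intro has_bochner_integral_sum has_bochner_integral_mult_right has_integral_cis_period)
  also have "(\<Sum>i\<le>e + d. of_nat ((e + d) choose i) * (if int i - int d = 0 then of_real (2 * pi) else 0)) =
      (\<Sum>i\<le>e + d. if i = d then of_real (2 * pi) * of_nat ((e + d) choose i) else (0::complex))"
    by (intro sum.cong) auto
  also have "\<dots> = of_real (2 * pi) * of_nat ((e + d) choose d)" by simp
  finally show ?thesis unfolding eq .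
qed

lemma integrable_fourier_integrand:
  "integrable lborel (\<lambda>\<theta>. indicator {-pi..pi} \<theta> *\<^sub>R fourier_integrand m k \<theta>)"
  by (intro borel_integrable_compact continuous_on_fourier_integrand) simp

lemma card_bounded_affine_permutations_fourier:
  assumes "n > 0"
  shows "of_real (2 * pi) * of_nat (card (bounded_affine_permutations n)) =
    (\<Sum>k\<le>n. of_nat (n choose k) * (-1) ^ k * 2 ^ (n - k) * fact (n - k) * fourier_coeff (n - k) k)"
proof -
  let ?f = "\<lambda>p. card {i\<in>{..<n}. p i = i}" and ?e = "\<lambda>p. card (exc {..<n} p)"
  let ?c = "\<lambda>k. of_nat (n choose k) * (-1) ^ k * 2 ^ (n - k) * fact (n - k) :: complex"
  have "has_bochner_integral lborel
      (\<lambda>\<theta>. \<Sum>p | p permutes {..<n}. indicator {-pi..pi} \<theta> *\<^sub>R ((1 + cis \<theta>) ^ ?e p * (1 + 1 / cis \<theta>) ^ (n - ?f p - ?e p)))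
      (\<Sum>p | p permutes {..<n}. of_real (2 * pi) * of_nat ((?e p + (n - ?f p - ?e p)) choose (n - ?f p - ?e p)))"
    by (intro has_bochner_integral_sum has_integral_binomial)
  also have "(\<Sum>p | p permutes {..<n}. of_real (2 * pi) * of_nat ((?e p + (n - ?f p - ?e p)) choose (n - ?f p - ?e p))) =
      (of_real (2 * pi) * of_nat (card (bounded_affine_permutations n)) :: complex)"
  proof -
    \<comment> \<open>Exceedances and anti-exceedances together are the non-fixed points; the
      truncated subtractions are exact.\<close>
    have "?e p + (n - ?f p - ?e p) = n - ?f p" for p using card_fix_exc_le[of n p] by linarith
    then show ?thesis
      unfolding card_bounded_affine_permutations[OF assms] of_nat_sum sum_distrib_left by simp
  qed
  also have "(\<lambda>\<theta>. \<Sum>p | p permutes {..<n}. indicator {-pi..pi} \<theta> *\<^sub>R ((1 + cis \<theta>) ^ ?e p * (1 + 1 / cis \<theta>) ^ (n - ?f p - ?e p))) =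
      (\<lambda>\<theta>. \<Sum>k\<le>n. ?c k * (indicator {-pi..pi} \<theta> *\<^sub>R fourier_integrand (n - k) k \<theta>))" (is "?l = ?r")
  proof
    fix \<theta>
    have "?l \<theta> = indicator {-pi..pi} \<theta> *\<^sub>R (\<Sum>k\<le>n. of_nat (n choose k) * (-1 / cis \<theta>) ^ k * (1 + 1 / cis \<theta>) ^ (n - k) * eulerian (n - k) (cis \<theta>))"
      unfolding scaleR_sum_right[symmetric] by (subst sum_permutes_fix_exc) simp_all
    also have "\<dots> = indicator {-pi..pi} \<theta> *\<^sub>R (\<Sum>k\<le>n. ?c k * fourier_integrand (n - k) k \<theta>)"
    proof (intro arg_cong[of _ _ "scaleR _"] sum.cong refl)
      fix k
      have "(-1 / cis \<theta>) ^ k = (-1) ^ k * (1 / cis \<theta>) ^ k" by (simp flip: power_mult_distrib)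
      then show "of_nat (n choose k) * (-1 / cis \<theta>) ^ k * (1 + 1 / cis \<theta>) ^ (n - k) * eulerian (n - k) (cis \<theta>) =
          ?c k * fourier_integrand (n - k) k \<theta>"
        by (simp only: fourier_integrand_def power_divide[of "1 + 1 / cis \<theta>"]) simp
    qed
    finally show "?l \<theta> = ?r \<theta>" by (simp add: scaleR_sum_right)
  qed
  finally have "(LINT \<theta>|lborel. (\<Sum>k\<le>n. ?c k * (indicator {-pi..pi} \<theta> *\<^sub>R fourier_integrand (n - k) k \<theta>))) =
      of_real (2 * pi) * of_nat (card (bounded_affine_permutations n))"
    by (rule has_bochner_integral_integral_eq)
  also have "(LINT \<theta>|lborel. (\<Sum>k\<le>n. ?c k * (indicator {-pi..pi} \<theta> *\<^sub>R fourier_integrand (n - k) k \<theta>))) =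
      (\<Sum>k\<le>n. ?c k * fourier_coeff (n - k) k)"
    unfolding fourier_coeff_def
    by (subst Bochner_Integration.integral_sum)
      (intro integrable_mult_right integrable_fourier_integrand, simp only: integral_mult_right_zero)
  finally show ?thesis by (rule sym)
qed

section \<open>Uniform bounds and summation by Tannery's theorem\<close>

lemma norm_fourier_coeff_0_le: "norm (fourier_coeff 0 k) \<le> 2 * pi"
proof -
  have "norm (fourier_coeff 0 k) \<le> (LINT \<theta>|lborel. indicator {-pi..pi} \<theta> *\<^sub>R (1::real))"
    unfolding fourier_coeff_def
  proof (rule Bochner_Integration.integral_norm_bound_integral[OF integrable_fourier_integrand])
    show "integrable lborel (\<lambda>\<theta>. indicator {-pi..pi} \<theta> *\<^sub>R (1::real))"
      by (intro borel_integrable_compact) auto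
  qed (simp add: indicator_def fourier_integrand_def norm_power norm_divide)
  then show ?thesis by simp
qed

text \<open>Replacing \<open>sqrt m\<close> by \<open>sqrt n\<close> costs at most
  \<open>sqrt (k + 1)\<close>. The generous \<open>2 ^ k\<close> is affordable: it cancels the
  factor \<open>(1 / 2) ^ k\<close> of the series.\<close>

lemma norm_sqrt_fourier_coeff_diff_le:
  assumes "k \<le> n"
  shows "norm (sqrt n * fourier_coeff (n - k) k) \<le> 2 ^ k * (2 * pi)"
proof -
  have le2: "real k + 1 \<le> 2 ^ k" using of_nat_mono[OF Suc_leI[OF less_exp[of k]], where 'a = real] by simp
  have sq: "sqrt x \<le> x" if "x \<ge> 1" for x :: real
    using that real_sqrt_le_mono[of x "x\<^sup>2"] by (simp add: power2_eq_square)
  show ?thesis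
  proof (cases "k = n")
    \<comment> \<open>At index 0 the bound on \<open>sqrt m * fourier_coeff m k\<close> is void, so
      the coefficient is bounded directly.\<close>
    case True
    have "sqrt n \<le> 2 ^ k"
    proof (cases "n = 0")
      case False
      then show ?thesis using sq[of n] le2 True by simp
    qed simp
    then have "sqrt n * norm (fourier_coeff 0 k) \<le> 2 ^ k * (2 * pi)"
      using norm_fourier_coeff_0_le[of k] by (intro mult_mono) auto
    then show ?thesis using True by (simp add: norm_mult)
  next
    case False
    define m where "m = n - k"
    have m: "m > 0" "n = m + k" using False assms by (auto simp: m_def)
    have "real n \<le> (real k + 1) * real m"
    proof -
      have "k * 1 \<le> k * m" using m(1) by (intro mult_left_mono) auto
      then have "n \<le> (k + 1) * m" using m by simp
      then show ?thesis by (metis of_nat_Suc of_nat_le_iff of_nat_mult Suc_eq_plus1 add.commute)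
    qed
    then have "sqrt n \<le> sqrt (real k + 1) * sqrt m" by (metis real_sqrt_le_mono real_sqrt_mult)
    also have "\<dots> \<le> 2 ^ k * sqrt m" using sq[of "real k + 1"] le2 by (intro mult_right_mono) auto
    finally have "sqrt n * norm (fourier_coeff m k) \<le> 2 ^ k * sqrt m * norm (fourier_coeff m k)"
      by (intro mult_right_mono) auto
    also have "\<dots> = 2 ^ k * norm (sqrt m * fourier_coeff m k)" by (simp add: norm_mult)
    also have "\<dots> \<le> 2 ^ k * sqrt (8 * pi)" by (intro mult_left_mono norm_sqrt_fourier_coeff_le) auto
    also have "sqrt (8 * pi) \<le> 2 * pi"
      using pi_ge_two by (intro real_le_lsqrt) (auto simp: power2_eq_square)
    finally show ?thesis by (simp add: norm_mult m_def)
  qed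
qed

lemma sqrt_fourier_coeff_diff_tendsto:
  "(\<lambda>n. sqrt n * fourier_coeff (n - k) k) \<longlonglongrightarrow> of_real (sqrt (6 * pi))"
proof -
  have "(\<lambda>m. sqrt (real (m + k)) / sqrt (real m)) \<longlonglongrightarrow> 1" by real_asymp
  then have 1: "(\<lambda>m. of_real (sqrt (real (m + k)) / sqrt (real m)) * (sqrt m * fourier_coeff m k)) \<longlonglongrightarrow> of_real 1 * of_real (sqrt (6 * pi))"
    by (intro tendsto_mult tendsto_of_real sqrt_fourier_coeff_tendsto)
  have 2: "\<forall>\<^sub>F m in sequentially. of_real (sqrt (real (m + k)) / sqrt (real m)) * (sqrt m * fourier_coeff m k) =
      sqrt (m + k) * fourier_coeff (m + k - k) k"
    using eventually_gt_at_top[of 0] by eventually_elim simp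
  have "(\<lambda>m. sqrt (m + k) * fourier_coeff (m + k - k) k) \<longlonglongrightarrow> of_real (sqrt (6 * pi))"
    using Lim_transform_eventually[OF 1 2] by (simp only: of_real_1 mult_1)
  then show ?thesis by (rule LIMSEQ_offset)
qed

lemma card_bounded_affine_permutations_tendsto:
  "(\<lambda>n. complex_of_real (2 * pi * (sqrt n * card (bounded_affine_permutations n) / (2 ^ n * fact n)))) \<longlonglongrightarrow>
     of_real (exp (- 1 / 2) * sqrt (6 * pi))"
proof -
  \<comment> \<open>Extension by zero beyond \<open>k = n\<close> turns the finite sum into a
    series, as Tannery's theorem requires.\<close>
  define a where "a k n = (if k \<le> n then (- 1 / 2) ^ k / fact k * (sqrt n * fourier_coeff (n - k) k) else 0)" for k n
  let ?b = "\<lambda>k. (- 1 / 2) ^ k / fact k * complex_of_real (sqrt (6 * pi))"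
  have lim: "(\<lambda>n. a k n) \<longlonglongrightarrow> ?b k" for k
  proof (rule Lim_transform_eventually)
    show "(\<lambda>n. (- 1 / 2) ^ k / fact k * (sqrt n * fourier_coeff (n - k) k)) \<longlonglongrightarrow> ?b k"
      by (intro tendsto_intros sqrt_fourier_coeff_diff_tendsto)
    show "\<forall>\<^sub>F n in sequentially. (- 1 / 2) ^ k / fact k * (sqrt n * fourier_coeff (n - k) k) = a k n"
      using eventually_ge_at_top[of k] by eventually_elim (simp add: a_def)
  qed
  have bound: "norm (a k n) \<le> 2 * pi * (1 / fact k)" for k n
  proof (cases "k \<le> n")
    case True
    have "norm (a k n) = (1 / 2) ^ k / fact k * norm (sqrt n * fourier_coeff (n - k) k)"
      using True by (simp add: a_def norm_mult norm_divide norm_power)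
    also have "\<dots> \<le> (1 / 2) ^ k / fact k * (2 ^ k * (2 * pi))"
      by (intro mult_left_mono norm_sqrt_fourier_coeff_diff_le True) auto
    also have "\<dots> = 2 * pi * (1 / fact k)" by (simp add: power_divide)
    finally show ?thesis .
  qed (simp add: a_def)
  have sum: "summable (\<lambda>k. 2 * pi * (1 / fact k))"
    using summable_exp[of "1::real"] by (intro summable_mult) (simp add: inverse_eq_divide)
  have tannery: "(\<lambda>n. suminf (\<lambda>k. a k n)) \<longlonglongrightarrow> suminf ?b"
    using tannerys_theorem[OF lim always_eventually sum sequentially_bot] bound by auto
  have "?b sums (exp (- 1 / 2) * of_real (sqrt (6 * pi)))"
  proof -
    have "x ^ k /\<^sub>R fact k = x ^ k / fact k" for k and x :: complex
      by (simp add: scaleR_conv_of_real field_simps)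
    then show ?thesis
      using sums_mult2[OF exp_converges[of "- 1 / 2 :: complex"], of "of_real (sqrt (6 * pi))"] by (simp only:)
  qed
  then have b: "suminf ?b = of_real (exp (- 1 / 2) * sqrt (6 * pi))"
    by (simp add: sums_unique[symmetric] exp_of_real[of "- 1 / 2", simplified, symmetric])
  have a: "suminf (\<lambda>k. a k n) = complex_of_real (2 * pi * (sqrt n * card (bounded_affine_permutations n) / (2 ^ n * fact n)))"
    if "n > 0" for n
  proof -
    have "suminf (\<lambda>k. a k n) = (\<Sum>k\<le>n. a k n)"
      by (intro suminf_finite) (auto simp: a_def)
    \<comment> \<open>The weights simplify:
      \<open>(n choose k) * 2 ^ (n - k) * fact (n - k) / (2 ^ n * fact n)\<close> equals
      \<open>(1 / 2) ^ k / fact k\<close>.\<close>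
    also have "\<dots> = (\<Sum>k\<le>n. (sqrt n / (2 ^ n * fact n)) * (of_nat (n choose k) * (-1) ^ k * 2 ^ (n - k) * fact (n - k) * fourier_coeff (n - k) k))"
    proof (intro sum.cong refl)
      fix k assume "k \<in> {..n}"
      then have k: "k \<le> n" by simp
      have b: "of_nat (n choose k) = (fact n / (fact k * fact (n - k)) :: complex)"
        using binomial_fact[OF k] .
      have p: "(2::complex) ^ n = 2 ^ k * 2 ^ (n - k)" using k by (simp flip: power_add)
      show "a k n = (sqrt n / (2 ^ n * fact n)) * (of_nat (n choose k) * (-1) ^ k * 2 ^ (n - k) * fact (n - k) * fourier_coeff (n - k) k)"
        unfolding a_def b power_divide using k by (simp add: p)
    qed
    also have "\<dots> = complex_of_real (sqrt n / (2 ^ n * fact n)) *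
        (of_real (2 * pi) * of_nat (card (bounded_affine_permutations n)))"
      unfolding card_bounded_affine_permutations_fourier[OF that] sum_distrib_left ..
    finally show ?thesis by simp
  qed
  have "\<forall>\<^sub>F n in sequentially. suminf (\<lambda>k. a k n) =
      complex_of_real (2 * pi * (sqrt n * card (bounded_affine_permutations n) / (2 ^ n * fact n)))"
    using eventually_gt_at_top[of 0] by eventually_elim (rule a)
  from Lim_transform_eventually[OF tannery this] show ?thesis by (simp only: b)
qed

theorem theorem7p7:
  shows "(\<lambda>n::nat. real (card (bounded_affine_permutations n)))
           \<sim>[at_top]
         (\<lambda>n. sqrt (3 / (2 * pi * exp 1)) * real n powr (-1/2) * 2 ^ n * fact n)"
proof (rule asymp_equivI')
  let ?c = "\<lambda>n. real (card (bounded_affine_permutations n))" and ?C = "sqrt (3 / (2 * pi * exp 1))"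
  \<comment> \<open>Both sides are nonnegative with square \<open>6 * pi / exp 1\<close>.\<close>
  have "2 * pi * ?C = exp (- 1 / 2) * sqrt (6 * pi)"
  proof (rule power2_eq_imp_eq)
    have "(exp (- 1 / 2 :: real))\<^sup>2 = 1 / exp 1"
      by (simp add: power2_eq_square exp_minus inverse_eq_divide flip: exp_add)
    moreover have "?C\<^sup>2 = 3 / (2 * pi * exp 1)" "(sqrt (6 * pi))\<^sup>2 = 6 * pi" by simp_all
    ultimately show "(2 * pi * ?C)\<^sup>2 = (exp (- 1 / 2) * sqrt (6 * pi))\<^sup>2"
      by (simp only: power_mult_distrib) (simp add: field_simps power2_eq_square)
  qed simp_all
  then have "(\<lambda>n. 2 * pi * (sqrt n * ?c n / (2 ^ n * fact n))) \<longlonglongrightarrow> 2 * pi * ?C"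
    using card_bounded_affine_permutations_tendsto unfolding tendsto_of_real_iff by simp
  then have "(\<lambda>n. 2 * pi * (sqrt n * ?c n / (2 ^ n * fact n)) / (2 * pi * ?C)) \<longlonglongrightarrow> 2 * pi * ?C / (2 * pi * ?C)"
    by (intro tendsto_divide tendsto_const) auto
  then have "(\<lambda>n. 2 * pi * (sqrt n * ?c n / (2 ^ n * fact n)) / (2 * pi * ?C)) \<longlonglongrightarrow> 1"
    by simp
  moreover have "\<forall>\<^sub>F n in sequentially. 2 * pi * (sqrt n * ?c n / (2 ^ n * fact n)) / (2 * pi * ?C) =
      ?c n / (?C * real n powr (-1/2) * 2 ^ n * fact n)"
    using eventually_gt_at_top[of 0]
    by eventually_elim (simp add: powr_minus powr_half_sqrt field_simps)
  ultimately show "(\<lambda>n. ?c n / (?C * real n powr (-1/2) * 2 ^ n * fact n)) \<longlonglongrightarrow> 1"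
    by (rule Lim_transform_eventually)
qed

end
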